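(* Let $(M,L)$ be a Finsler manifold and let $L\to\overline{L}=e^{\sigma}L+\beta$, $\beta=b_i(x)y^i$, be a $\beta$-conformal change. Then the canonical spray $\overline{S}^r$ and the Cartan nonlinear connection $\overline{N}^r_j$ of $(M,\overline{L})$ are determined by those of $(M,L)$ through $$\overline{S}^r=S^r+D^r_{00},\qquad \overline{N}^r_j=N^r_j+D^r_{0j},$$ where $$D^r_{00}=2Le^{-\sigma}F^r_0+\frac{L}{\overline{L}}\,(E_{00}-2Le^{-\sigma}F_{\beta0})L^r-L^2\sigma^r+\frac{L}{\overline{L}}\,(2Le^{\sigma}\sigma_0+L^2\sigma_\beta)L^r,$$ $$D^i_{0j}=L\,G^i{}_j+\frac{L}{\overline{L}}\,(G_j-L G_{\beta j})\,L^i,\qquad G^i{}_j=g^{ir}G_{rj},\quad G_{\beta j}=b^iG_{ij},$$ with $$G_{ij}=e^{-\sigma}F_{ij}-\tfrac12 L_{ijr}D^r_{00}+\tfrac12(\sigma_0L_{ij}-\mu_{ij}),\qquad G_i=E_{0i}-\tfrac12 e^{\sigma}L_{ir}D^r_{00}+\tfrac12 e^{\sigma}(\sigma_0L_i+\sigma_iL).$$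
   Context: $M$ is an $n$-dimensional $C^\infty$ manifold, $L(x,y)$ a Finsler metric function; all objects are considered in local coordinates $(x^i,y^i)$ at $y\neq0$. A $\beta$-conformal change is $L\to\overline{L}=e^{\sigma}L+\beta$, with $\sigma$ a smooth function on $M$ and $\beta=b_i(x)y^i$ a 1-form on $M$; $\overline{L}$ is assumed to be a Finsler metric function too. $\partial_i=\partial/\partial x^i$, $\dot\partial_i=\partial/\partial y^i$; summation convention; the index $0$ denotes contraction with $y$ (e.g. $F_{i0}=F_{ij}y^j$, $E_{0i}=E_{ji}y^j$, $\sigma_0=\sigma_jy^j$). Notation for $(M,L)$: $g_{ij}=\frac12\dot\partial_i\dot\partial_jL^2$ with inverse $g^{ij}$; $L_i=\dot\partial_iL$, $L^i=y^i/L$; $L_{ij}=\dot\partial_jL_i$, $L_{ijk}=\dot\partial_kL_{ij}$. Canonical spray (normalized so that $S^i=\Gamma^i_{jk}y^jy^k$): $S^i=\frac12g^{ir}(y^k\partial_k\dot\partial_rL^2-\partial_rL^2)$. Cartan nonlinear connection: $N^i_j=\frac12\dot\partial_jS^i=y^k\Gamma^i_{jk}$. Here $\delta_k=\partial_k-N^r_k\dot\partial_r$ and $\Gamma^i_{jk}=\frac12g^{ir}(\delta_jg_{rk}+\delta_kg_{rj}-\delta_rg_{jk})$ are the Cartan connection coefficients. Bars denote the same objects built from $\overline{L}$. The $h$-covariant derivative of $b_i$ is $b_{i|j}=\delta_jb_i-b_r\Gamma^r_{ij}$. Further: $\sigma_i=\partial_i\sigma$, $\sigma^r=g^{ri}\sigma_i$,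 $b^i=g^{ij}b_j$, $\sigma_\beta=\sigma_ib^i$, $E_{ij}=\frac12(b_{i|j}+b_{j|i})$, $F_{ij}=\frac12(b_{i|j}-b_{j|i})$, $F^r_0=g^{ir}F_{i0}$, $F_{\beta0}=F_{i0}b^i$, $\mu_{ij}=\sigma_iL_j-\sigma_jL_i$. *)

theory Defs
  imports "HOL-Analysis.Analysis"
begin

section \<open>Smooth manifolds and their tangent bundle\<close>

text \<open>Functions of class \<open>C\<^sup>k\<close> and \<open>C\<^sup>\<infinity>\<close>; \<open>S\<close> is meant to be open.\<close>

primrec Ck_on :: "nat \<Rightarrow> ('a::real_normed_vector) set \<Rightarrow> ('a \<Rightarrow> 'b::real_normed_vector) \<Rightarrow> bool" where
  "Ck_on 0 S f \<longleftrightarrow> continuous_on S f"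
| "Ck_on (Suc k) S f \<longleftrightarrow>
     (\<forall>x\<in>S. f differentiable (at x)) \<and> (\<forall>v. Ck_on k S (\<lambda>x. frechet_derivative f (at x) v))"

definition smooth_on :: "('a::real_normed_vector) set \<Rightarrow> ('a \<Rightarrow> 'b::real_normed_vector) \<Rightarrow> bool" where
  "smooth_on S f \<longleftrightarrow> (\<forall>k. Ck_on k S f)"

text \<open>A chart is a pair of a domain and a coordinate map.\<close>

type_synonym ('m, 'n) chart = "'m set \<times> ('m \<Rightarrow> real ^ 'n)"

definition chart_image :: "('m, 'n) chart \<Rightarrow> (real ^ 'n) set" where
  "chart_image c = snd c ` fst c"

definition param :: "('m, 'n) chart \<Rightarrow> real ^ 'n \<Rightarrow> 'm" where
  "param c = inv_into (fst c) (snd c)"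

text \<open>The Hausdorff and second countability conditions are the sort constraint on \<open>'m\<close>;
  the dimension is \<open>CARD('n)\<close>. The atlas need not be maximal.\<close>

definition smooth_atlas ::
    "('m::{t2_space,second_countable_topology}, 'n::finite) chart set \<Rightarrow> bool" where
  "smooth_atlas A \<longleftrightarrow>
     (\<forall>c\<in>A. open (fst c) \<and> open (chart_image c) \<and>
        homeomorphism (fst c) (chart_image c) (snd c) (param c)) \<and>
     (\<Union>c\<in>A. fst c) = UNIV \<and>
     (\<forall>c\<in>A. \<forall>d\<in>A. smooth_on (snd c ` (fst c \<inter> fst d)) (snd d \<circ> param c))"

definition smooth_fun :: "('m, 'n::finite) chart set \<Rightarrow> ('m \<Rightarrow> real) \<Rightarrow> bool" where
  "smooth_fun A f \<longleftrightarrow> (\<forall>c\<in>A. smooth_on (chart_image c) (f \<circ> param c))"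

text \<open>A tangent vector is its base point together with a derivation of the smooth functions.
  \<open>tvec A c (x, y)\<close> is the vector \<open>y\<^sup>i \<partial>\<^sub>i\<close> at the point with coordinates \<open>x\<close> in the chart \<open>c\<close>.
  On functions that are not smooth a derivation has the dummy value 0.\<close>

type_synonym 'm tangent = "'m \<times> (('m \<Rightarrow> real) \<Rightarrow> real)"

definition tvec ::
    "('m, 'n::finite) chart set \<Rightarrow> ('m, 'n) chart \<Rightarrow> (real ^ 'n) \<times> (real ^ 'n) \<Rightarrow> 'm tangent" where
  "tvec A c z =
     (param c (fst z),
      \<lambda>f. if smooth_fun A f then frechet_derivative (f \<circ> param c) (at (fst z)) (snd z) else 0)"

definition tangent_bundle :: "('m, 'n::finite) chart set \<Rightarrow> 'm tangent set" where
  "tangent_bundle A = {tvec A c (x, y) | c x y. c \<in> A \<and> x \<in> chart_image c}"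


section \<open>Local coordinate objects\<close>

text \<open>A function of the local coordinates \<open>(x, y)\<close>. The partial derivatives \<open>\<partial>\<^sub>i\<close> and
  \<open>\<partial>/\<partial>y\<^sup>i\<close> are the total derivative applied to the coordinate directions.\<close>

type_synonym 'n fld = "(real ^ 'n) \<times> (real ^ 'n) \<Rightarrow> real"

definition dx :: "'n::finite \<Rightarrow> 'n fld \<Rightarrow> 'n fld" where
  "dx i f z = frechet_derivative f (at z) (axis i 1, 0)"

definition dy :: "'n::finite \<Rightarrow> 'n fld \<Rightarrow> 'n fld" where
  "dy i f z = frechet_derivative f (at z) (0, axis i 1)"

text \<open>Coordinate expressions of a function on the tangent bundle, of a function on the manifold
  (regarded as a function of \<open>(x, y)\<close>), and of the components \<open>b\<^sub>i(x)\<close> of a 1-form.\<close>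

definition loc :: "('m, 'n::finite) chart set \<Rightarrow> ('m, 'n) chart \<Rightarrow> ('m tangent \<Rightarrow> real) \<Rightarrow> 'n fld" where
  "loc A c L z = L (tvec A c z)"

definition loc_fun :: "('m, 'n::finite) chart \<Rightarrow> ('m \<Rightarrow> real) \<Rightarrow> 'n fld" where
  "loc_fun c \<sigma> z = \<sigma> (param c (fst z))"

definition loc_form ::
    "('m, 'n::finite) chart set \<Rightarrow> ('m, 'n) chart \<Rightarrow> ('m tangent \<Rightarrow> real) \<Rightarrow> 'n \<Rightarrow> 'n fld" where
  "loc_form A c \<beta> i z = \<beta> (tvec A c (fst z, axis i 1))"

definition g_lo :: "'n::finite fld \<Rightarrow> 'n \<Rightarrow> 'n \<Rightarrow> 'n fld" where
  "g_lo L i j z = 1/2 * dy i (dy j (\<lambda>w. (L w)\<^sup>2)) z"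

definition g_up :: "'n::finite fld \<Rightarrow> 'n \<Rightarrow> 'n \<Rightarrow> 'n fld" where
  "g_up L i j z = matrix_inv (\<chi> p q. g_lo L p q z) $ i $ j"

definition L_1 :: "'n::finite fld \<Rightarrow> 'n \<Rightarrow> 'n fld" where
  "L_1 L i = dy i L"

definition L_2 :: "'n::finite fld \<Rightarrow> 'n \<Rightarrow> 'n \<Rightarrow> 'n fld" where
  "L_2 L i j = dy j (L_1 L i)"

definition L_3 :: "'n::finite fld \<Rightarrow> 'n \<Rightarrow> 'n \<Rightarrow> 'n \<Rightarrow> 'n fld" where
  "L_3 L i j k = dy k (L_2 L i j)"

definition L_up :: "'n::finite fld \<Rightarrow> 'n \<Rightarrow> 'n fld" where
  "L_up L i z = snd z $ i / L z"

definition spray :: "'n::finite fld \<Rightarrow> 'n \<Rightarrow> 'n fld" where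
  "spray L i z = 1/2 * (\<Sum>r\<in>UNIV. g_up L i r z *
     ((\<Sum>k\<in>UNIV. snd z $ k * dx k (dy r (\<lambda>w. (L w)\<^sup>2)) z) - dx r (\<lambda>w. (L w)\<^sup>2) z))"

definition nonlin_conn :: "'n::finite fld \<Rightarrow> 'n \<Rightarrow> 'n \<Rightarrow> 'n fld" where
  "nonlin_conn L i j z = 1/2 * dy j (spray L i) z"

definition delta :: "'n::finite fld \<Rightarrow> 'n \<Rightarrow> 'n fld \<Rightarrow> 'n fld" where
  "delta L k f z = dx k f z - (\<Sum>r\<in>UNIV. nonlin_conn L r k z * dy r f z)"

definition cartan_coeff :: "'n::finite fld \<Rightarrow> 'n \<Rightarrow> 'n \<Rightarrow> 'n \<Rightarrow> 'n fld" where
  "cartan_coeff L i j k z = 1/2 * (\<Sum>r\<in>UNIV. g_up L i r z *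
     (delta L j (g_lo L r k) z + delta L k (g_lo L r j) z - delta L r (g_lo L j k) z))"


section \<open>Finsler structures, 1-forms and beta-conformal changes\<close>

text \<open>Strong convexity (positive definiteness of \<open>g\<^sub>i\<^sub>j\<close>) is part of the notion of a Finsler metric;
  \<open>L\<close> is smooth off the zero section only.\<close>

definition finsler_metric :: "('m, 'n::finite) chart set \<Rightarrow> ('m tangent \<Rightarrow> real) \<Rightarrow> bool" where
  "finsler_metric A L \<longleftrightarrow> (\<forall>c\<in>A.
     smooth_on (chart_image c \<times> (- {0})) (loc A c L) \<and>
     (\<forall>x\<in>chart_image c. \<forall>y.
        (y \<noteq> 0 \<longrightarrow> loc A c L (x, y) > 0) \<and>
        (\<forall>t>0. loc A c L (x, t *\<^sub>R y) = t * loc A c L (x, y)) \<and>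
        (y \<noteq> 0 \<longrightarrow> (\<forall>v. v \<noteq> 0 \<longrightarrow>
           (\<Sum>i\<in>UNIV. \<Sum>j\<in>UNIV. g_lo (loc A c L) i j (x, y) * v $ i * v $ j) > 0))))"

text \<open>A 1-form is identified with the function \<open>b\<^sub>i(x) y\<^sup>i\<close> on the tangent bundle.\<close>

definition one_form :: "('m, 'n::finite) chart set \<Rightarrow> ('m tangent \<Rightarrow> real) \<Rightarrow> bool" where
  "one_form A \<beta> \<longleftrightarrow> (\<forall>c\<in>A.
     (\<forall>i. smooth_on (chart_image c) (\<lambda>x. \<beta> (tvec A c (x, axis i 1)))) \<and>
     (\<forall>x\<in>chart_image c. \<forall>y.
        \<beta> (tvec A c (x, y)) = (\<Sum>i\<in>UNIV. \<beta> (tvec A c (x, axis i 1)) * y $ i)))"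

definition beta_conformal_change ::
    "('m, 'n::finite) chart set \<Rightarrow> ('m \<Rightarrow> real) \<Rightarrow> ('m tangent \<Rightarrow> real) \<Rightarrow>
     ('m tangent \<Rightarrow> real) \<Rightarrow> ('m tangent \<Rightarrow> real) \<Rightarrow> bool" where
  "beta_conformal_change A \<sigma> \<beta> L L' \<longleftrightarrow>
     (\<forall>v\<in>tangent_bundle A. L' v = exp (\<sigma> (fst v)) * L v + \<beta> v)"

text \<open>In the following, \<open>L\<close>, \<open>L'\<close>, \<open>s\<close> and \<open>b\<close> are the coordinate expressions of the two metric
  functions, of \<open>\<sigma>\<close>, and of the components of \<open>\<beta>\<close>. A suffix 0 denotes contraction with \<open>y\<close>.\<close>

definition b_cov :: "'n::finite fld \<Rightarrow> ('n \<Rightarrow> 'n fld) \<Rightarrow> 'n \<Rightarrow> 'n \<Rightarrow> 'n fld" where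
  "b_cov L b i j z = delta L j (b i) z - (\<Sum>r\<in>UNIV. b r z * cartan_coeff L r i j z)"

definition E_lo :: "'n::finite fld \<Rightarrow> ('n \<Rightarrow> 'n fld) \<Rightarrow> 'n \<Rightarrow> 'n \<Rightarrow> 'n fld" where
  "E_lo L b i j z = 1/2 * (b_cov L b i j z + b_cov L b j i z)"

definition F_lo :: "'n::finite fld \<Rightarrow> ('n \<Rightarrow> 'n fld) \<Rightarrow> 'n \<Rightarrow> 'n \<Rightarrow> 'n fld" where
  "F_lo L b i j z = 1/2 * (b_cov L b i j z - b_cov L b j i z)"

definition E_0 :: "'n::finite fld \<Rightarrow> ('n \<Rightarrow> 'n fld) \<Rightarrow> 'n \<Rightarrow> 'n fld" where
  "E_0 L b i z = (\<Sum>j\<in>UNIV. E_lo L b j i z * snd z $ j)"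

definition E_00 :: "'n::finite fld \<Rightarrow> ('n \<Rightarrow> 'n fld) \<Rightarrow> 'n fld" where
  "E_00 L b z = (\<Sum>i\<in>UNIV. \<Sum>j\<in>UNIV. E_lo L b i j z * snd z $ i * snd z $ j)"

definition b_up :: "'n::finite fld \<Rightarrow> ('n \<Rightarrow> 'n fld) \<Rightarrow> 'n \<Rightarrow> 'n fld" where
  "b_up L b i z = (\<Sum>j\<in>UNIV. g_up L i j z * b j z)"

definition F_0 :: "'n::finite fld \<Rightarrow> ('n \<Rightarrow> 'n fld) \<Rightarrow> 'n \<Rightarrow> 'n fld" where
  "F_0 L b i z = (\<Sum>j\<in>UNIV. F_lo L b i j z * snd z $ j)"

definition F_up_0 :: "'n::finite fld \<Rightarrow> ('n \<Rightarrow> 'n fld) \<Rightarrow> 'n \<Rightarrow> 'n fld" where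
  "F_up_0 L b r z = (\<Sum>i\<in>UNIV. g_up L i r z * F_0 L b i z)"

definition F_beta_0 :: "'n::finite fld \<Rightarrow> ('n \<Rightarrow> 'n fld) \<Rightarrow> 'n fld" where
  "F_beta_0 L b z = (\<Sum>i\<in>UNIV. F_0 L b i z * b_up L b i z)"

definition s_lo :: "'n::finite fld \<Rightarrow> 'n \<Rightarrow> 'n fld" where
  "s_lo s i = dx i s"

definition s_up :: "'n::finite fld \<Rightarrow> 'n fld \<Rightarrow> 'n \<Rightarrow> 'n fld" where
  "s_up L s r z = (\<Sum>i\<in>UNIV. g_up L r i z * s_lo s i z)"

definition s_0 :: "'n::finite fld \<Rightarrow> 'n fld" where
  "s_0 s z = (\<Sum>j\<in>UNIV. s_lo s j z * snd z $ j)"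

definition s_beta :: "'n::finite fld \<Rightarrow> 'n fld \<Rightarrow> ('n \<Rightarrow> 'n fld) \<Rightarrow> 'n fld" where
  "s_beta L s b z = (\<Sum>i\<in>UNIV. s_lo s i z * b_up L b i z)"

definition mu :: "'n::finite fld \<Rightarrow> 'n fld \<Rightarrow> 'n \<Rightarrow> 'n \<Rightarrow> 'n fld" where
  "mu L s i j z = s_lo s i z * L_1 L j z - s_lo s j z * L_1 L i z"

definition D_00 :: "'n::finite fld \<Rightarrow> 'n fld \<Rightarrow> 'n fld \<Rightarrow> ('n \<Rightarrow> 'n fld) \<Rightarrow> 'n \<Rightarrow> 'n fld" where
  "D_00 L L' s b r z =
     2 * L z * exp (- s z) * F_up_0 L b r z
     + L z / L' z * (E_00 L b z - 2 * L z * exp (- s z) * F_beta_0 L b z) * L_up L r z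
     - (L z)\<^sup>2 * s_up L s r z
     + L z / L' z * (2 * L z * exp (s z) * s_0 s z + (L z)\<^sup>2 * s_beta L s b z) * L_up L r z"

definition G_2 :: "'n::finite fld \<Rightarrow> 'n fld \<Rightarrow> 'n fld \<Rightarrow> ('n \<Rightarrow> 'n fld) \<Rightarrow> 'n \<Rightarrow> 'n \<Rightarrow> 'n fld" where
  "G_2 L L' s b i j z =
     exp (- s z) * F_lo L b i j z
     - 1/2 * (\<Sum>r\<in>UNIV. L_3 L i j r z * D_00 L L' s b r z)
     + 1/2 * (s_0 s z * L_2 L i j z - mu L s i j z)"

definition G_1 :: "'n::finite fld \<Rightarrow> 'n fld \<Rightarrow> 'n fld \<Rightarrow> ('n \<Rightarrow> 'n fld) \<Rightarrow> 'n \<Rightarrow> 'n fld" where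
  "G_1 L L' s b i z =
     E_0 L b i z
     - 1/2 * exp (s z) * (\<Sum>r\<in>UNIV. L_2 L i r z * D_00 L L' s b r z)
     + 1/2 * exp (s z) * (s_0 s z * L_1 L i z + s_lo s i z * L z)"

definition G_up :: "'n::finite fld \<Rightarrow> 'n fld \<Rightarrow> 'n fld \<Rightarrow> ('n \<Rightarrow> 'n fld) \<Rightarrow> 'n \<Rightarrow> 'n \<Rightarrow> 'n fld" where
  "G_up L L' s b i j z = (\<Sum>r\<in>UNIV. g_up L i r z * G_2 L L' s b r j z)"

definition G_beta :: "'n::finite fld \<Rightarrow> 'n fld \<Rightarrow> 'n fld \<Rightarrow> ('n \<Rightarrow> 'n fld) \<Rightarrow> 'n \<Rightarrow> 'n fld" where
  "G_beta L L' s b j z = (\<Sum>i\<in>UNIV. b_up L b i z * G_2 L L' s b i j z)"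

definition D_0 :: "'n::finite fld \<Rightarrow> 'n fld \<Rightarrow> 'n fld \<Rightarrow> ('n \<Rightarrow> 'n fld) \<Rightarrow> 'n \<Rightarrow> 'n \<Rightarrow> 'n fld" where
  "D_0 L L' s b i j z =
     L z * G_up L L' s b i j z
     + L z / L' z * (G_1 L L' s b j z - L z * G_beta L L' s b j z) * L_up L i z"

end

theory Submission
  imports Defs
begin

text \<open>
  Write \<open>D = S' - S\<close> for the difference of the two sprays. The Euler--Lagrange equations
  \<open>L\<^sub>i\<^sub>r S\<^sup>r = y\<^sup>k \<partial>\<^sub>k L\<^sub>i - \<partial>\<^sub>i L\<close> and their contraction \<open>L\<^sub>r S\<^sup>r = y\<^sup>k \<partial>\<^sub>k L\<close>, taken for both metrics
  and subtracted, give a linear system for \<open>D\<close> whose right-hand side consists of first derivatives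
  of \<open>\<sigma>\<close> and \<open>\<beta>\<close>. Since \<open>L L\<^sub>i\<^sub>r = g\<^sub>i\<^sub>r - L\<^sub>i L\<^sub>r\<close>, it has exactly one solution, which is \<open>D\<^sup>r\<^sub>0\<^sub>0\<close>.
  Differentiating the system in \<open>y\<close> gives one of the same shape for the difference of the nonlinear
  connections. The \<open>h\<close>-covariant derivatives enter through \<open>\<Gamma>\<^sup>i\<^sub>j\<^sub>k y\<^sup>k = N\<^sup>i\<^sub>j\<close> and
  \<open>N\<^sup>i\<^sub>j y\<^sup>j = S\<^sup>i\<close>, which follow from differentiating \<open>g\<^sub>i\<^sub>r S\<^sup>r\<close> in \<open>y\<close>.
\<close>

section \<open>Calculus of smooth functions\<close>

lemma Ck_on_Suc_imp: "Ck_on (Suc k) S f \<Longrightarrow> Ck_on k S f"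
proof (induction k arbitrary: f)
  case 0
  then show ?case
    by (auto intro!: continuous_at_imp_continuous_on differentiable_imp_continuous_within)
next
  case (Suc k)
  then show ?case by (metis Ck_on.simps(2))
qed

text \<open>A derivative at a point depends only on a neighbourhood of it, so agreement on the open
  set \<open>S\<close> is inherited by \<open>frechet_derivative\<close>, and the induction can
  proceed.\<close>

lemma Ck_on_cong:
  assumes "open S" "Ck_on k S f" "\<And>x. x \<in> S \<Longrightarrow> f x = g x"
  shows "Ck_on k S g"
  using assms(2,3)
proof (induction k arbitrary: f g)
  case 0
  then show ?case by (simp cong: continuous_on_cong)
next
  case (Suc k)
  have d: "(g has_derivative frechet_derivative f (at x)) (at x)" if "x \<in> S" for x
    using Suc.prems that \<open>open S\<close> has_derivative_transform_within_open
    by (metis Ck_on.simps(2) frechet_derivative_works)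
  then have "frechet_derivative g (at x) = frechet_derivative f (at x)" if "x \<in> S" for x
    using frechet_derivative_at that by metis
  then have "Ck_on k S (\<lambda>x. frechet_derivative g (at x) v)" for v
    using Suc.IH[of "\<lambda>x. frechet_derivative f (at x) v"] Suc.prems(1) by simp
  then show ?case using d by (auto simp: differentiable_def)
qed

lemma Ck_on_add:
  assumes "open S" "Ck_on k S f" "Ck_on k S g"
  shows "Ck_on k S (\<lambda>x. f x + g x)"
  using assms(2,3)
proof (induction k arbitrary: f g)
  case 0
  then show ?case by (simp add: continuous_on_add)
next
  case (Suc k)
  have eq: "frechet_derivative f (at x) v + frechet_derivative g (at x) v
      = frechet_derivative (\<lambda>x. f x + g x) (at x) v" if "x \<in> S" for x v
    using that Suc.prems
    by (auto simp: frechet_derivative_works intro!: fun_cong[OF frechet_derivative_at] has_derivative_add)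
  have "Ck_on k S (\<lambda>x. frechet_derivative (\<lambda>x. f x + g x) (at x) v)" for v
    using Suc.prems by (intro Ck_on_cong[OF \<open>open S\<close> Suc.IH eq]) auto
  then show ?case using Suc.prems by auto
qed

lemma Ck_on_mult:
  fixes f g :: "'a::real_normed_vector \<Rightarrow> 'b::real_normed_algebra"
  assumes "open S" "Ck_on k S f" "Ck_on k S g"
  shows "Ck_on k S (\<lambda>x. f x * g x)"
  using assms(2,3)
proof (induction k arbitrary: f g)
  case 0
  then show ?case by (simp add: continuous_on_mult)
next
  case (Suc k)
  have eq: "f x * frechet_derivative g (at x) v + frechet_derivative f (at x) v * g x
      = frechet_derivative (\<lambda>x. f x * g x) (at x) v" if "x \<in> S" for x v
    using that Suc.prems
    by (auto simp: frechet_derivative_works intro!: fun_cong[OF frechet_derivative_at] has_derivative_mult)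
  \<comment> \<open>The Leibniz rule also contains undifferentiated factors;
    \<open>Ck_on_Suc_imp\<close> lowers them to class \<open>k\<close>.\<close>
  have "Ck_on k S (\<lambda>x. frechet_derivative (\<lambda>x. f x * g x) (at x) v)" for v
    using Suc.prems Ck_on_Suc_imp[OF Suc.prems(1)] Ck_on_Suc_imp[OF Suc.prems(2)]
    by (intro Ck_on_cong[OF \<open>open S\<close> _ eq] Ck_on_add[OF \<open>open S\<close>] Suc.IH) auto
  then show ?case using Suc.prems by auto
qed

lemma smooth_on_frechet_derivative:
  assumes "smooth_on S f"
  shows "smooth_on S (\<lambda>x. frechet_derivative f (at x) v)"
  using assms unfolding smooth_on_def by (metis Ck_on.simps(2))

lemma smooth_on_const [simp]: "smooth_on S (\<lambda>x. c)"
proof -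
  have "Ck_on k S (\<lambda>x. c)" for k :: nat and c :: 'b
    by (induction k arbitrary: c) auto
  then show ?thesis by (simp add: smooth_on_def)
qed

lemma smooth_on_mult:
  fixes f g :: "'a::real_normed_vector \<Rightarrow> 'b::real_normed_algebra"
  shows "open S \<Longrightarrow> smooth_on S f \<Longrightarrow> smooth_on S g \<Longrightarrow> smooth_on S (\<lambda>x. f x * g x)"
  by (simp add: smooth_on_def Ck_on_mult)

lemma smooth_on_imp_differentiable: "smooth_on S f \<Longrightarrow> x \<in> S \<Longrightarrow> f differentiable (at x)"
  unfolding smooth_on_def by (metis Ck_on.simps(2))

lemma smooth_on_imp_isCont:
  "open S \<Longrightarrow> smooth_on S f \<Longrightarrow> x \<in> S \<Longrightarrow> isCont f x"
  by (metis differentiable_imp_continuous_within smooth_on_imp_differentiable)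

section \<open>Symmetry of second derivatives\<close>

lemma has_real_derivative_along_line:
  fixes F :: "'a::real_normed_vector \<Rightarrow> real"
  assumes "F differentiable (at (p + s *\<^sub>R u))"
  shows "((\<lambda>s. F (p + s *\<^sub>R u)) has_real_derivative frechet_derivative F (at (p + s *\<^sub>R u)) u) (at s)"
proof -
  have F: "(F has_derivative frechet_derivative F (at (p + s *\<^sub>R u))) (at (p + s *\<^sub>R u))"
    using assms by (simp add: frechet_derivative_works)
  have "((\<lambda>s. p + s *\<^sub>R u) has_derivative (\<lambda>k. k *\<^sub>R u)) (at s)"
    by (auto intro!: derivative_eq_intros)
  from has_derivative_compose[OF this F] show ?thesis
    by (rule has_derivative_imp_has_field_derivative)
       (simp add: linear_cmul[OF has_derivative_linear[OF F]])
qed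

text \<open>The mean value theorem is applied twice: first in the direction \<open>u\<close>, to the
  difference of \<open>f\<close> along two parallel segments, then in the direction
  \<open>v\<close>, to the derivative along \<open>u\<close>.\<close>

lemma double_difference_mean_value:
  fixes f :: "'a::real_normed_vector \<Rightarrow> real"
  assumes f: "smooth_on S f" and "0 < h"
    and S: "\<And>s t. 0 \<le> s \<Longrightarrow> s \<le> h \<Longrightarrow> 0 \<le> t \<Longrightarrow> t \<le> h \<Longrightarrow> x + s *\<^sub>R u + t *\<^sub>R v \<in> S"
  obtains s t where "0 \<le> s" "s \<le> h" "0 \<le> t" "t \<le> h"
    "f (x + h *\<^sub>R u + h *\<^sub>R v) - f (x + h *\<^sub>R u) - f (x + h *\<^sub>R v) + f x
      = h * h * frechet_derivative (\<lambda>z. frechet_derivative f (at z) u) (at (x + s *\<^sub>R u + t *\<^sub>R v)) v"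
proof -
  have dv: "((\<lambda>t. F (x + s *\<^sub>R u + t *\<^sub>R v)) has_real_derivative
      frechet_derivative F (at (x + s *\<^sub>R u + t *\<^sub>R v)) v) (at t)"
    if "0 \<le> s" "s \<le> h" "0 \<le> t" "t \<le> h" "smooth_on S F" for s t F
    using that S smooth_on_imp_differentiable by (blast intro: has_real_derivative_along_line)
  have du: "((\<lambda>s. F (x + s *\<^sub>R u + t *\<^sub>R v)) has_real_derivative
      frechet_derivative F (at (x + s *\<^sub>R u + t *\<^sub>R v)) u) (at s)"
    if "0 \<le> s" "s \<le> h" "0 \<le> t" "t \<le> h" "smooth_on S F" for s t F
    using has_real_derivative_along_line[of F "x + t *\<^sub>R v" s u]
      smooth_on_imp_differentiable[OF that(5) S[OF that(1-4)]] by (simp add: add_ac)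
  define fu where "fu z = frechet_derivative f (at z) u" for z
  have "smooth_on S fu"
    unfolding fu_def by (rule smooth_on_frechet_derivative[OF f])
  obtain s where s: "0 < s" "s < h"
    "(f (x + h *\<^sub>R u + h *\<^sub>R v) - f (x + h *\<^sub>R u)) - (f (x + h *\<^sub>R v) - f x)
      = h * (fu (x + s *\<^sub>R u + h *\<^sub>R v) - fu (x + s *\<^sub>R u))"
    \<comment> \<open>The summand \<open>0 *\<^sub>R v\<close> gives both terms the shape that
      \<open>du\<close> handles, with \<open>t = h\<close> and \<open>t = 0\<close>.\<close>
    using MVT2[of 0 h "\<lambda>s. f (x + s *\<^sub>R u + h *\<^sub>R v) - f (x + s *\<^sub>R u + 0 *\<^sub>R v)"
        "\<lambda>s. fu (x + s *\<^sub>R u + h *\<^sub>R v) - fu (x + s *\<^sub>R u + 0 *\<^sub>R v)"] \<open>0 < h\<close>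
      du[OF _ _ _ _ f, folded fu_def]
    by (force intro!: DERIV_diff)
  obtain t where t: "0 < t" "t < h"
    "fu (x + s *\<^sub>R u + h *\<^sub>R v) - fu (x + s *\<^sub>R u)
      = h * frechet_derivative fu (at (x + s *\<^sub>R u + t *\<^sub>R v)) v"
    using MVT2[of 0 h "\<lambda>t. fu (x + s *\<^sub>R u + t *\<^sub>R v)"
        "\<lambda>t. frechet_derivative fu (at (x + s *\<^sub>R u + t *\<^sub>R v)) v"] \<open>0 < h\<close>
      dv[OF _ _ _ _ \<open>smooth_on S fu\<close>] s(1,2) by force
  show thesis
    using s t that[of s t] unfolding fu_def[abs_def] by (simp add: algebra_simps)
qed

text \<open>Schwarz's theorem. The second difference over a small parallelogram is symmetric in
  \<open>u\<close> and \<open>v\<close>, and it equals \<open>h * h\<close> times either mixed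
  derivative at some nearby point. By continuity the mixed derivatives at \<open>x\<close> cannot
  differ.\<close>

lemma frechet_derivative_commute:
  fixes f :: "'a::real_normed_vector \<Rightarrow> real"
  assumes "open S" and f: "smooth_on S f" and "x \<in> S"
  shows "frechet_derivative (\<lambda>z. frechet_derivative f (at z) u) (at x) v
       = frechet_derivative (\<lambda>z. frechet_derivative f (at z) v) (at x) u"
proof (rule ccontr)
  define a where "a z = frechet_derivative (\<lambda>z. frechet_derivative f (at z) u) (at z) v" for z
  define b where "b z = frechet_derivative (\<lambda>z. frechet_derivative f (at z) v) (at z) u" for z
  assume "\<not> ?thesis"
  then have e: "0 < dist (a x) (b x) / 2" (is "0 < ?e") by (simp add: a_def b_def)
  have "isCont a x" "isCont b x"
    unfolding a_def b_def
    by (intro smooth_on_imp_isCont[OF \<open>open S\<close>] smooth_on_frechet_derivative assms)+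
  then obtain d1 d2 where d: "0 < d1" "\<And>z. dist z x < d1 \<Longrightarrow> dist (a z) (a x) < ?e"
    "0 < d2" "\<And>z. dist z x < d2 \<Longrightarrow> dist (b z) (b x) < ?e"
    using e unfolding continuous_at_eps_delta by metis
  obtain d3 where d3: "0 < d3" "ball x d3 \<subseteq> S"
    using \<open>open S\<close> \<open>x \<in> S\<close> open_contains_ball by blast
  define m where "m = Min {d1, d2, d3}"
  have m: "0 < m" "m \<le> d1" "m \<le> d2" "m \<le> d3"
    using d d3 by (auto simp: m_def)
  \<comment> \<open>The parallelogram stays within \<open>h * (norm u + norm v)\<close> of
    \<open>x\<close>, which is below \<open>m\<close>; the summand 1 keeps the denominator positive
    even if both directions vanish.\<close>
  define h where "h = m / (2 * (norm u + norm v + 1))"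
  have h: "0 < h" using m by (simp add: h_def add_nonneg_pos)
  have near: "dist (x + s *\<^sub>R u + t *\<^sub>R v) x < m"
    if "0 \<le> s" "s \<le> h" "0 \<le> t" "t \<le> h" for s t
  proof -
    have "dist (x + s *\<^sub>R u + t *\<^sub>R v) x \<le> s * norm u + t * norm v"
      using norm_triangle_ineq[of "s *\<^sub>R u" "t *\<^sub>R v"] that by (simp add: dist_norm add.assoc)
    also have "\<dots> \<le> h * norm u + h * norm v"
      using that by (intro add_mono mult_right_mono) auto
    also have "\<dots> < 2 * h * (norm u + norm v + 1)"
      using h by (simp add: algebra_simps add_pos_nonneg add_nonneg_pos)
    also have "\<dots> = m"
      using add_nonneg_pos[of "norm u + norm v" 1] by (simp add: h_def field_simps)
    finally show ?thesis .
  qed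
  then have S: "x + s *\<^sub>R u + t *\<^sub>R v \<in> S" if "0 \<le> s" "s \<le> h" "0 \<le> t" "t \<le> h" for s t
    using that m(4) d3(2) by (force simp: dist_commute)
  then have S': "x + s *\<^sub>R v + t *\<^sub>R u \<in> S" if "0 \<le> s" "s \<le> h" "0 \<le> t" "t \<le> h" for s t
    using that by (metis add.assoc add.commute)
  obtain s t where st: "0 \<le> s" "s \<le> h" "0 \<le> t" "t \<le> h"
    "f (x + h *\<^sub>R u + h *\<^sub>R v) - f (x + h *\<^sub>R u) - f (x + h *\<^sub>R v) + f x
      = h * h * a (x + s *\<^sub>R u + t *\<^sub>R v)"
    using double_difference_mean_value[OF f h S] unfolding a_def by blast
  obtain s' t' where st': "0 \<le> s'" "s' \<le> h" "0 \<le> t'" "t' \<le> h"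
    "f (x + h *\<^sub>R v + h *\<^sub>R u) - f (x + h *\<^sub>R v) - f (x + h *\<^sub>R u) + f x
      = h * h * b (x + s' *\<^sub>R v + t' *\<^sub>R u)"
    using double_difference_mean_value[OF f h S'] unfolding b_def by blast
  \<comment> \<open>In the second representation the directions are exchanged, so \<open>s'\<close>
    belongs to \<open>v\<close> and \<open>t'\<close> to \<open>u\<close>.\<close>
  have "h * h * a (x + s *\<^sub>R u + t *\<^sub>R v) = h * h * b (x + t' *\<^sub>R u + s' *\<^sub>R v)"
    unfolding st(5)[symmetric] using st'(5) by (simp add: add_ac)
  then have "a (x + s *\<^sub>R u + t *\<^sub>R v) = b (x + t' *\<^sub>R u + s' *\<^sub>R v)"
    using h by simp
  moreover have "dist (a (x + s *\<^sub>R u + t *\<^sub>R v)) (a x) < ?e"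
    using near[OF st(1-4)] m(2) by (intro d(2)) linarith
  moreover have "dist (b (x + t' *\<^sub>R u + s' *\<^sub>R v)) (b x) < ?e"
    using near[OF st'(3,4,1,2)] m(3) by (intro d(4)) linarith
  \<comment> \<open>Both mixed derivatives would lie within half of their distance of one common
    value.\<close>
  ultimately show False
    using dist_triangle_half_r[of _ "a x" "dist (a x) (b x)" "b x"] by fastforce
qed

lemma sum_delta_mult [simp]:
  fixes f :: "'n::finite \<Rightarrow> real"
  shows "(\<Sum>j\<in>UNIV. (if i = j then 1 else 0) * f j) = f i"
    and "(\<Sum>j\<in>UNIV. (if j = i then 1 else 0) * f j) = f i"
    and "(\<Sum>j\<in>UNIV. f j * (if i = j then 1 else 0)) = f i"
    and "(\<Sum>j\<in>UNIV. f j * (if j = i then 1 else 0)) = f i"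
  by (simp_all add: if_distrib if_distribR cong: if_cong)

section \<open>Coordinate derivatives\<close>

lemma frechet_derivative_direction:
  fixes f g :: "'a::real_normed_vector \<Rightarrow> real"
  assumes f: "f differentiable (at z)"
  shows "g differentiable (at z) \<Longrightarrow> frechet_derivative (\<lambda>w. f w + g w) (at z) v
      = frechet_derivative f (at z) v + frechet_derivative g (at z) v"
    and "g differentiable (at z) \<Longrightarrow> frechet_derivative (\<lambda>w. f w - g w) (at z) v
      = frechet_derivative f (at z) v - frechet_derivative g (at z) v"
    and "g differentiable (at z) \<Longrightarrow> frechet_derivative (\<lambda>w. f w * g w) (at z) v
      = frechet_derivative f (at z) v * g z + f z * frechet_derivative g (at z) v"
    and "frechet_derivative (\<lambda>w. exp (f w)) (at z) v = exp (f z) * frechet_derivative f (at z) v"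
    and "frechet_derivative (\<lambda>w. (f w)\<^sup>2) (at z) v = 2 * f z * frechet_derivative f (at z) v"
proof -
  note F = f[unfolded frechet_derivative_works]
  show "frechet_derivative (\<lambda>w. exp (f w)) (at z) v = exp (f z) * frechet_derivative f (at z) v"
    by (rule fun_cong[OF frechet_derivative_at, symmetric]) (auto intro!: derivative_eq_intros F)
  show "frechet_derivative (\<lambda>w. (f w)\<^sup>2) (at z) v = 2 * f z * frechet_derivative f (at z) v"
    by (rule fun_cong[OF frechet_derivative_at, symmetric]) (auto intro!: derivative_eq_intros F)
  assume "g differentiable (at z)"
  note G = this[unfolded frechet_derivative_works]
  show "frechet_derivative (\<lambda>w. f w + g w) (at z) v
      = frechet_derivative f (at z) v + frechet_derivative g (at z) v"
    by (rule fun_cong[OF frechet_derivative_at, symmetric]) (auto intro!: derivative_eq_intros F G)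
  show "frechet_derivative (\<lambda>w. f w - g w) (at z) v
      = frechet_derivative f (at z) v - frechet_derivative g (at z) v"
    by (rule fun_cong[OF frechet_derivative_at, symmetric]) (auto intro!: derivative_eq_intros F G)
  show "frechet_derivative (\<lambda>w. f w * g w) (at z) v
      = frechet_derivative f (at z) v * g z + f z * frechet_derivative g (at z) v"
    by (rule fun_cong[OF frechet_derivative_at, symmetric]) (auto intro!: derivative_eq_intros F G)
qed

lemma frechet_derivative_sum:
  fixes f :: "'i \<Rightarrow> 'a::real_normed_vector \<Rightarrow> real"
  assumes "\<And>i. i \<in> I \<Longrightarrow> f i differentiable (at z)"
  shows "frechet_derivative (\<lambda>w. \<Sum>i\<in>I. f i w) (at z) v = (\<Sum>i\<in>I. frechet_derivative (f i) (at z) v)"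
  using assms
  by (intro fun_cong[OF frechet_derivative_at, symmetric])
     (auto intro!: has_derivative_sum simp: frechet_derivative_works)

lemma has_derivative_snd_nth:
  "((\<lambda>w. snd w $ k) has_derivative (\<lambda>v. snd v $ k)) (at z)"
  by (intro bounded_linear.has_derivative[OF bounded_linear_vec_nth] has_derivative_snd has_derivative_ident)

lemma differentiable_snd_nth [simp]: "(\<lambda>w. snd w $ k) differentiable (at z)"
  using has_derivative_snd_nth differentiable_def by blast

lemma differentiable_exp [simp]:
  fixes f :: "'a::real_normed_vector \<Rightarrow> real"
  shows "f differentiable (at z) \<Longrightarrow> (\<lambda>w. exp (f w)) differentiable (at z)"
  unfolding differentiable_def by (blast intro: has_derivative_exp)

lemma differentiable_cong_open:
  assumes "open U" "z \<in> U" "f differentiable (at z)" "\<And>w. w \<in> U \<Longrightarrow> f w = g w"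
  shows "g differentiable (at z)"
  using assms by (metis differentiable_def has_derivative_transform_within_open)

lemma differentiable_prod_real:
  fixes f :: "'i \<Rightarrow> 'a::real_normed_vector \<Rightarrow> real"
  shows "(\<And>i. i \<in> I \<Longrightarrow> f i differentiable (at z)) \<Longrightarrow> (\<lambda>w. \<Prod>i\<in>I. f i w) differentiable (at z)"
  by (induct I rule: infinite_finite_induct) auto

text \<open>The determinant is a polynomial in the entries. This serves to differentiate the spray
  through Cramer's rule.\<close>

lemma differentiable_det:
  fixes f :: "'a::real_normed_vector \<Rightarrow> real^'n^'n"
  assumes "\<And>i j. (\<lambda>w. f w $ i $ j) differentiable (at z)"
  shows "(\<lambda>w. det (f w)) differentiable (at z)"
  unfolding det_def
  by (intro differentiable_sum differentiable_mult differentiable_const differentiable_prod_real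
      finite_permutations finite ballI assms)

section \<open>Rules for the partial derivatives in \<open>x\<close> and \<open>y\<close>\<close>

lemma
  assumes "f differentiable (at z)"
  shows dy_add: "g differentiable (at z) \<Longrightarrow> dy i (\<lambda>w. f w + g w) z = dy i f z + dy i g z"
    and dy_diff: "g differentiable (at z) \<Longrightarrow> dy i (\<lambda>w. f w - g w) z = dy i f z - dy i g z"
    and dy_mult: "g differentiable (at z) \<Longrightarrow> dy i (\<lambda>w. f w * g w) z = dy i f z * g z + f z * dy i g z"
    and dy_exp: "dy i (\<lambda>w. exp (f w)) z = exp (f z) * dy i f z"
    and dy_square: "dy i (\<lambda>w. (f w)\<^sup>2) z = 2 * f z * dy i f z"
  using assms by (simp_all add: dy_def frechet_derivative_direction)

lemma
  assumes "f differentiable (at z)"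
  shows dx_add: "g differentiable (at z) \<Longrightarrow> dx i (\<lambda>w. f w + g w) z = dx i f z + dx i g z"
    and dx_mult: "g differentiable (at z) \<Longrightarrow> dx i (\<lambda>w. f w * g w) z = dx i f z * g z + f z * dx i g z"
    and dx_exp: "dx i (\<lambda>w. exp (f w)) z = exp (f z) * dx i f z"
    and dx_square: "dx i (\<lambda>w. (f w)\<^sup>2) z = 2 * f z * dx i f z"
  using assms by (simp_all add: dx_def frechet_derivative_direction)

lemma dy_sum: "(\<And>a. a \<in> I \<Longrightarrow> f a differentiable (at z)) \<Longrightarrow> dy i (\<lambda>w. \<Sum>a\<in>I. f a w) z = (\<Sum>a\<in>I. dy i (f a) z)"
  by (simp add: dy_def frechet_derivative_sum)

lemma dx_sum: "(\<And>a. a \<in> I \<Longrightarrow> f a differentiable (at z)) \<Longrightarrow> dx i (\<lambda>w. \<Sum>a\<in>I. f a w) z = (\<Sum>a\<in>I. dx i (f a) z)"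
  by (simp add: dx_def frechet_derivative_sum)

lemma dy_const [simp]: "dy i (\<lambda>w. c) z = 0"
  and dx_const [simp]: "dx i (\<lambda>w. c) z = 0"
  by (simp_all add: dx_def dy_def)

lemma dy_minus: "f differentiable (at z) \<Longrightarrow> dy i (\<lambda>w. - f w) z = - dy i f z"
  using dy_diff[of "\<lambda>_. 0" z f i] by simp

lemma dy_snd_nth [simp]: "dy i (\<lambda>w. snd w $ k) z = (if k = i then 1 else 0)"
  and dx_snd_nth [simp]: "dx i (\<lambda>w. snd w $ k) z = 0"
  by (simp_all add: dx_def dy_def frechet_derivative_at[OF has_derivative_snd_nth, symmetric] axis_def)

text \<open>This allows an identity known on an open set to be differentiated at a point of
  it.\<close>

lemma dy_cong:
  assumes "open U" "z \<in> U" "f differentiable (at z)" "\<And>w. w \<in> U \<Longrightarrow> f w = g w"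
  shows "dy i f z = dy i g z"
  using frechet_derivative_transform_within_open[OF assms(3,1,2)] assms(4) by (simp add: dy_def)

lemma dx_cong:
  assumes "open U" "z \<in> U" "f differentiable (at z)" "\<And>w. w \<in> U \<Longrightarrow> f w = g w"
  shows "dx i f z = dx i g z"
  using frechet_derivative_transform_within_open[OF assms(3,1,2)] assms(4) by (simp add: dx_def)

lemma smooth_on_dy: "smooth_on U f \<Longrightarrow> smooth_on U (dy i f)"
  and smooth_on_dx: "smooth_on U f \<Longrightarrow> smooth_on U (dx i f)"
  unfolding dx_def[abs_def] dy_def[abs_def] by (simp_all add: smooth_on_frechet_derivative)

lemma dy_dy_commute:
  "open U \<Longrightarrow> smooth_on U f \<Longrightarrow> z \<in> U \<Longrightarrow> dy i (dy j f) z = dy j (dy i f) z"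
  unfolding dy_def[abs_def] by (rule frechet_derivative_commute)

lemma dy_dx_commute:
  "open U \<Longrightarrow> smooth_on U f \<Longrightarrow> z \<in> U \<Longrightarrow> dy i (dx j f) z = dx j (dy i f) z"
  unfolding dx_def[abs_def] dy_def[abs_def] by (rule frechet_derivative_commute)

lemma base_derivatives:
  assumes "open X" "smooth_on X f" "fst z \<in> X"
  shows dy_base: "dy i (\<lambda>w. f (fst w)) z = 0"
    and dx_base: "dx i (\<lambda>w. f (fst w)) z = frechet_derivative f (at (fst z)) (axis i 1)"
    and differentiable_base: "(\<lambda>w. f (fst w)) differentiable (at z)"
proof -
  have d: "((\<lambda>z. f (fst z)) has_derivative (\<lambda>v. frechet_derivative f (at (fst z)) (fst v))) (at z)"
    using smooth_on_imp_differentiable[OF assms(2,3)]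
    by (intro has_derivative_compose[OF has_derivative_fst[OF has_derivative_ident]])
       (auto simp: frechet_derivative_works)
  then show "(\<lambda>w. f (fst w)) differentiable (at z)" by (auto simp: differentiable_def)
  show "dy i (\<lambda>w. f (fst w)) z = 0"
    "dx i (\<lambda>w. f (fst w)) z = frechet_derivative f (at (fst z)) (axis i 1)"
    using linear_0[OF linear_frechet_derivative[OF smooth_on_imp_differentiable[OF assms(2,3)]]]
    by (simp_all add: dx_def dy_def frechet_derivative_at[OF d, symmetric])
qed

text \<open>Linearity applied to the expansion of \<open>y\<close> along the axes; it turns the
  radial derivative into the sum in Euler's relation.\<close>

lemma frechet_derivative_snd_eq_sum:
  assumes "f differentiable (at z)"
  shows "frechet_derivative f (at z) (0, y) = (\<Sum>i\<in>UNIV. y $ i * dy i f z)"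
proof -
  interpret linear "frechet_derivative f (at z)"
    by (rule linear_frechet_derivative[OF assms])
  have "(\<Sum>i\<in>UNIV. y $ i *\<^sub>R axis i 1) = y"
    using basis_expansion[of y] by (simp add: scalar_mult_eq_scaleR)
  then have "(\<Sum>i\<in>UNIV. y $ i *\<^sub>R (0, axis i 1)) = (0, y)"
    by (simp add: prod_eq_iff fst_sum snd_sum)
  then have "frechet_derivative f (at z) (0, y)
      = frechet_derivative f (at z) (\<Sum>i\<in>UNIV. y $ i *\<^sub>R (0, axis i 1))"
    by (rule arg_cong[OF sym])
  then show ?thesis
    by (simp only: sum scale dy_def real_scaleR_def)
qed

section \<open>The geometry of a Finsler function in one chart\<close>

text \<open>The local computations need no manifold, only an open set of coordinates and a function
  on it. The theorem instantiates \<open>X\<close> with a chart image and \<open>L\<close> with a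
  coordinate expression.\<close>

locale finsler_chart =
  fixes X :: "(real ^ 'n::finite) set" and L :: "'n fld"
  assumes open_X: "open X"
    and smooth_L: "smooth_on (X \<times> - {0}) L"
    and L_pos: "z \<in> X \<times> - {0} \<Longrightarrow> L z > 0"
    and L_homogeneous: "x \<in> X \<Longrightarrow> t > 0 \<Longrightarrow> L (x, t *\<^sub>R y) = t * L (x, y)"
    and g_lo_pos_def: "z \<in> X \<times> - {0} \<Longrightarrow> v \<noteq> 0 \<Longrightarrow>
      (\<Sum>i\<in>UNIV. \<Sum>j\<in>UNIV. g_lo L i j z * v $ i * v $ j) > 0"
begin

definition U where "U = X \<times> - {0 :: real ^ 'n}"

abbreviation Q :: "'n fld" where "Q \<equiv> (\<lambda>w. (L w)\<^sup>2)"

lemma open_U: "open U"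
  unfolding U_def by (intro open_Times open_X) (simp add: open_delete[of UNIV, simplified] Compl_eq_Diff_UNIV)

lemma smooth_U: "smooth_on U L" "smooth_on U Q"
  using smooth_L smooth_on_mult[OF open_U, of L L] by (simp_all add: U_def power2_eq_square)

lemmas smooth_U_deriv = smooth_U smooth_on_dy smooth_on_dx

lemma smooth_g_lo: "smooth_on U (g_lo L i j)"
proof -
  have "g_lo L i j = (\<lambda>z. 1 / 2 * dy i (dy j Q) z)"
    by (auto simp: g_lo_def)
  then show ?thesis
    by (simp add: smooth_on_mult[OF open_U] smooth_U_deriv del: times_divide_eq_left)
qed

lemma differentiable_U [simp]: "smooth_on U f \<Longrightarrow> z \<in> U \<Longrightarrow> f differentiable (at z)"
  by (rule smooth_on_imp_differentiable)

section \<open>Homogeneity and the Euler relations\<close>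

context
  fixes z :: "(real ^ 'n) \<times> (real ^ 'n)"
  assumes z: "z \<in> U"
begin

text \<open>The function \<open>L (x, t *\<^sub>R y) = t * L (x, y)\<close> of \<open>t\<close> is
  differentiated at \<open>t = 1\<close> in two ways.\<close>

lemma euler_L: "(\<Sum>i\<in>UNIV. snd z $ i * dy i L z) = L z"
proof -
  have *: "L differentiable (at z)" using z smooth_U by simp
  have "((\<lambda>t. (fst z, t *\<^sub>R snd z)) has_derivative (\<lambda>k. (0, k *\<^sub>R snd z))) (at 1)"
    by (auto intro!: derivative_eq_intros)
  from has_derivative_compose[OF this, of L "frechet_derivative L (at z)"] *
  have "((\<lambda>t. L (fst z, t *\<^sub>R snd z)) has_derivative (\<lambda>k. frechet_derivative L (at z) (0, k *\<^sub>R snd z))) (at 1)"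
    by (simp add: frechet_derivative_works)
  moreover have "((\<lambda>t. L (fst z, t *\<^sub>R snd z)) has_derivative (\<lambda>k. k * L z)) (at 1)"
  proof (rule has_derivative_transform_within_open)
    show "((\<lambda>t. t * L z) has_derivative (\<lambda>k. k * L z)) (at 1)"
      by (auto intro!: derivative_eq_intros)
    \<comment> \<open>Homogeneity is assumed for positive \<open>t\<close> only; these form an open
      neighbourhood of 1.\<close>
    show "open {0::real<..}" "1 \<in> {0::real<..}" by auto
    show "t * L z = L (fst z, t *\<^sub>R snd z)" if "t \<in> {0<..}" for t
      using L_homogeneous[of "fst z" t "snd z"] z that by (auto simp: U_def)
  qed
  ultimately have "frechet_derivative L (at z) (0, 1 *\<^sub>R snd z) = 1 * L z"
    using has_derivative_unique by metis
  then show ?thesis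
    using frechet_derivative_snd_eq_sum[OF *, of "snd z"] by simp
qed

lemma dy_Q: "dy i Q z = 2 * L z * dy i L z"
  and dx_Q: "dx i Q z = 2 * L z * dx i L z"
  using z by (simp_all add: dy_square dx_square smooth_U)

lemma euler_Q: "(\<Sum>i\<in>UNIV. snd z $ i * dy i Q z) = 2 * Q z"
proof -
  have "(\<Sum>i\<in>UNIV. snd z $ i * dy i Q z) = 2 * L z * (\<Sum>i\<in>UNIV. snd z $ i * dy i L z)"
    by (simp add: dy_Q sum_distrib_left algebra_simps)
  then show ?thesis by (simp add: euler_L power2_eq_square)
qed

lemma g_lo_sym: "g_lo L i j z = g_lo L j i z"
  using dy_dy_commute[OF open_U smooth_U(2) z] by (simp add: g_lo_def)

end

text \<open>Euler's relation for \<open>Q\<close>, which is homogeneous of degree two,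
  differentiated once in \<open>y\<close> and once in \<open>x\<close>.\<close>

lemma
  assumes z: "z \<in> U"
  shows g_lo_contract: "(\<Sum>j\<in>UNIV. snd z $ j * g_lo L r j z) = 1/2 * dy r Q z"
    and dx_dQ_contract: "(\<Sum>j\<in>UNIV. snd z $ j * dx r (dy j Q) z) = 2 * dx r Q z"
proof -
  have "dy r (\<lambda>w. \<Sum>j\<in>UNIV. snd w $ j * dy j Q w) z = dy r (\<lambda>w. 2 * Q w) z"
    by (rule dy_cong[OF open_U z]) (use z in \<open>auto simp: euler_Q smooth_U_deriv simp del: power2_eq_square\<close>)
  then show "(\<Sum>j\<in>UNIV. snd z $ j * g_lo L r j z) = 1/2 * dy r Q z"
    using z by (simp add: dy_sum dy_mult smooth_U_deriv sum.distrib g_lo_def sum_divide_distrib[symmetric])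
  have "dx r (\<lambda>w. \<Sum>j\<in>UNIV. snd w $ j * dy j Q w) z = dx r (\<lambda>w. 2 * Q w) z"
    by (rule dx_cong[OF open_U z]) (use z in \<open>auto simp: euler_Q smooth_U_deriv\<close>)
  then show "(\<Sum>j\<in>UNIV. snd z $ j * dx r (dy j Q) z) = 2 * dx r Q z"
    using z by (simp add: dx_sum dx_mult smooth_U_deriv)
qed

text \<open>The contraction \<open>g_lo_contract\<close> is differentiated once more. In
  \<open>y\<close> the product rule returns \<open>g_lo\<close> itself, which cancels against the
  right-hand side.\<close>

lemma
  assumes z: "z \<in> U"
  shows dy_g_lo_contract: "(\<Sum>j\<in>UNIV. snd z $ j * dy i (g_lo L r j) z) = 0"
    and dx_g_lo_contract: "(\<Sum>j\<in>UNIV. snd z $ j * dx i (g_lo L r j) z) = 1/2 * dx i (dy r Q) z"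
proof -
  have "dy i (\<lambda>w. \<Sum>j\<in>UNIV. snd w $ j * g_lo L r j w) z = dy i (\<lambda>w. 1/2 * dy r Q w) z"
    by (rule dy_cong[OF open_U z]) (use z in \<open>auto simp: g_lo_contract smooth_g_lo\<close>)
  then have "(\<Sum>j\<in>UNIV. snd z $ j * dy i (g_lo L r j) z) + g_lo L r i z = g_lo L i r z"
    using z by (simp add: dy_sum dy_mult smooth_U_deriv smooth_g_lo sum.distrib g_lo_def[of L i r z] del: times_divide_eq_left)
  then show "(\<Sum>j\<in>UNIV. snd z $ j * dy i (g_lo L r j) z) = 0"
    using g_lo_sym[OF z, of i r] by simp
  have "dx i (\<lambda>w. \<Sum>j\<in>UNIV. snd w $ j * g_lo L r j w) z = dx i (\<lambda>w. 1/2 * dy r Q w) z"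
    by (rule dx_cong[OF open_U z]) (use z in \<open>auto simp: g_lo_contract smooth_g_lo\<close>)
  then show "(\<Sum>j\<in>UNIV. snd z $ j * dx i (g_lo L r j) z) = 1/2 * dx i (dy r Q) z"
    using z by (simp add: dx_sum dx_mult smooth_U_deriv smooth_g_lo del: times_divide_eq_left)
qed

text \<open>Third derivatives of \<open>Q\<close> commute; in particular
  \<open>dy k (g_lo L i j)\<close> is totally symmetric.\<close>

lemma
  assumes z: "z \<in> U"
  shows dy_g_lo_sym: "dy k (g_lo L i j) z = dy k (g_lo L j i) z"
    and dx_g_lo_sym: "dx k (g_lo L i j) z = dx k (g_lo L j i) z"
    and dy_g_lo_swap: "dy k (g_lo L i j) z = dy i (g_lo L k j) z"
    and dy_dx_dy_Q: "dy j (dx k (dy r Q)) z = 2 * dx k (g_lo L r j) z"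
proof -
  show "dy k (g_lo L i j) z = dy k (g_lo L j i) z" for i j k
    by (rule dy_cong[OF open_U z]) (use z in \<open>auto simp: g_lo_sym[of _ i j] smooth_g_lo\<close>)
  show *: "dx k (g_lo L i j) z = dx k (g_lo L j i) z" for i j k
    by (rule dx_cong[OF open_U z]) (use z in \<open>auto simp: g_lo_sym[of _ i j] smooth_g_lo\<close>)
  have d: "g_lo L i j = (\<lambda>z. 1 / 2 * dy i (dy j Q) z)" for i j
    by (auto simp: g_lo_def)
  show "dy k (g_lo L i j) z = dy i (g_lo L k j) z"
    using z dy_dy_commute[OF open_U smooth_on_dy[OF smooth_U(2)] z, of k i j]
    by (simp add: d dy_mult smooth_U_deriv del: times_divide_eq_left)
  have "dy j (dx k (dy r Q)) z = dx k (dy j (dy r Q)) z"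
    by (rule dy_dx_commute[OF open_U smooth_on_dy[OF smooth_U(2)] z])
  also have "\<dots> = 2 * dx k (g_lo L j r) z"
    using z by (simp add: d dx_mult smooth_U_deriv del: times_divide_eq_left)
  finally show "dy j (dx k (dy r Q)) z = 2 * dx k (g_lo L r j) z"
    by (simp add: *[of k r j])
qed

section \<open>The inverse metric\<close>

lemma
  assumes z: "z \<in> U"
  shows g_up_g_lo: "(\<Sum>r\<in>UNIV. g_up L i r z * g_lo L r j z) = (if i = j then 1 else 0)"
    and g_lo_g_up: "(\<Sum>r\<in>UNIV. g_lo L i r z * g_up L r j z) = (if i = j then 1 else 0)"
    and det_g_lo: "det (\<chi> p q. g_lo L p q z) \<noteq> 0"
proof -
  define M where "M = (\<chi> p q. g_lo L p q z)"
  \<comment> \<open>Positive definiteness excludes a kernel: a nonzero \<open>v\<close> with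
    \<open>M *v v = 0\<close> would make the quadratic form vanish.\<close>
  have "v = 0" if "M *v v = 0" for v
  proof (rule ccontr)
    assume "v \<noteq> 0"
    have "v $ i * (M *v v) $ i = (\<Sum>j\<in>UNIV. g_lo L i j z * v $ i * v $ j)" for i
      by (simp add: M_def matrix_vector_mult_def sum_distrib_left algebra_simps)
    then have "(\<Sum>i\<in>UNIV. \<Sum>j\<in>UNIV. g_lo L i j z * v $ i * v $ j) = 0"
      using that by (simp flip: \<open>\<And>i. v $ i * (M *v v) $ i = _\<close>)
    then show False using g_lo_pos_def[of z v] z \<open>v \<noteq> 0\<close> by (simp add: U_def)
  qed
  then have inv: "invertible M"
    by (simp add: invertible_left_inverse matrix_left_invertible_ker)
  then show "det (\<chi> p q. g_lo L p q z) \<noteq> 0"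
    by (simp add: invertible_det_nz M_def)
  \<comment> \<open>\<open>matrix_inv\<close> is a choice among two-sided inverses, so the existence
    of one suffices.\<close>
  have "M ** matrix_inv M = mat 1 \<and> matrix_inv M ** M = mat 1"
    using inv unfolding invertible_def matrix_inv_def by (rule someI_ex)
  then show "(\<Sum>r\<in>UNIV. g_up L i r z * g_lo L r j z) = (if i = j then 1 else 0)"
    "(\<Sum>r\<in>UNIV. g_lo L i r z * g_up L r j z) = (if i = j then 1 else 0)"
    by (simp_all add: g_up_def M_def[symmetric] vec_eq_iff matrix_matrix_mult_def mat_def)
       (simp_all add: M_def)
qed

lemma g_up_sum_g_lo:
  assumes z: "z \<in> U"
  shows "(\<Sum>r\<in>UNIV. g_up L i r z * (\<Sum>s\<in>UNIV. g_lo L r s z * v s)) = v i"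
proof -
  have "(\<Sum>r\<in>UNIV. g_up L i r z * (\<Sum>s\<in>UNIV. g_lo L r s z * v s))
      = (\<Sum>s\<in>UNIV. (\<Sum>r\<in>UNIV. g_up L i r z * g_lo L r s z) * v s)"
    unfolding sum_distrib_left sum_distrib_right by (subst sum.swap) (simp add: mult.assoc)
  then show ?thesis using z by (simp add: g_up_g_lo)
qed

lemma g_lo_sum_g_up:
  assumes z: "z \<in> U"
  shows "(\<Sum>r\<in>UNIV. g_lo L i r z * (\<Sum>s\<in>UNIV. g_up L r s z * v s)) = v i"
proof -
  have "(\<Sum>r\<in>UNIV. g_lo L i r z * (\<Sum>s\<in>UNIV. g_up L r s z * v s))
      = (\<Sum>s\<in>UNIV. (\<Sum>r\<in>UNIV. g_lo L i r z * g_up L r s z) * v s)"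
    unfolding sum_distrib_left sum_distrib_right by (subst sum.swap) (simp add: mult.assoc)
  then show ?thesis using z by (simp add: g_lo_g_up)
qed

text \<open>Lowering an index is injective, so identities between contravariant components may be
  checked after lowering.\<close>

lemma g_lo_cancel:
  assumes z: "z \<in> U" and "\<And>r. (\<Sum>s\<in>UNIV. g_lo L r s z * v s) = (\<Sum>s\<in>UNIV. g_lo L r s z * w s)"
  shows "v i = w i"
  using g_up_sum_g_lo[OF z, of i v] g_up_sum_g_lo[OF z, of i w] assms(2) by simp

lemma g_up_sym:
  assumes z: "z \<in> U"
  shows "g_up L i j z = g_up L j i z"
proof (rule g_lo_cancel[OF z, of "\<lambda>i. g_up L i j z"])
  fix r
  have "(\<Sum>s\<in>UNIV. g_lo L r s z * g_up L j s z) = (\<Sum>s\<in>UNIV. g_up L j s z * g_lo L s r z)"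
    using z by (simp add: g_lo_sym[of _ r] mult.commute)
  then show "(\<Sum>s\<in>UNIV. g_lo L r s z * g_up L s j z) = (\<Sum>s\<in>UNIV. g_lo L r s z * g_up L j s z)"
    using z by (simp add: g_up_g_lo g_lo_g_up eq_commute)
qed

section \<open>The spray and its nonlinear connection\<close>

lemma spray_eq:
  assumes z: "z \<in> U"
  shows "(\<Sum>i\<in>UNIV. g_lo L r i z * spray L i z)
    = 1/2 * ((\<Sum>k\<in>UNIV. snd z $ k * dx k (dy r Q) z) - dx r Q z)"
  using g_lo_sum_g_up[OF z, of r "\<lambda>r. 1/2 * ((\<Sum>k\<in>UNIV. snd z $ k * dx k (dy r Q) z) - dx r Q z)"]
  unfolding spray_def sum_distrib_left by (simp only: mult.left_commute mult.assoc)

text \<open>The definition of the spray goes through \<open>matrix_inv\<close>, which hides its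
  regularity. Cramer's rule applied to \<open>spray_eq\<close> exhibits it as a quotient of
  determinants with differentiable entries.\<close>

lemma differentiable_spray:
  assumes z: "z \<in> U"
  shows "spray L k differentiable (at z)"
proof -
  define R where "R w = (\<chi> r. 1/2 * ((\<Sum>k\<in>UNIV. snd w $ k * dx k (dy r Q) w) - dx r Q w))" for w
  have "spray L k w = det (\<chi> i j. if j = k then R w $ i else g_lo L i j w) / det (\<chi> i j. g_lo L i j w)"
    if w: "w \<in> U" for w
  proof -
    have "(\<chi> i j. g_lo L i j w) *v (\<chi> i. spray L i w) = R w"
      by (simp add: vec_eq_iff matrix_vector_mult_def spray_eq[OF w] R_def)
    then have "(\<chi> i. spray L i w)
        = (\<chi> k. det (\<chi> i j. if j = k then R w $ i else (\<chi> i j. g_lo L i j w) $ i $ j) / det (\<chi> i j. g_lo L i j w))"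
      using cramer[OF det_g_lo[OF w]] by blast
    then show ?thesis by (simp add: vec_eq_iff cong: if_cong)
  qed
  moreover have "(\<lambda>w. det (\<chi> i j. if j = k then R w $ i else g_lo L i j w) / det (\<chi> i j. g_lo L i j w))
      differentiable (at z)"
  proof (intro differentiable_divide differentiable_det)
    show "det (\<chi> i j. g_lo L i j z) \<noteq> 0" by (rule det_g_lo[OF z])
    have "(\<lambda>w. R w $ i) differentiable (at z)" for i
      using z unfolding R_def by (simp add: smooth_U_deriv del: times_divide_eq_left)
    then show "(\<lambda>w. (\<chi> i j. if j = k then R w $ i else g_lo L i j w) $ i $ j) differentiable (at z)" for i j
      using z by (cases "j = k") (simp_all add: smooth_g_lo)
    show "(\<lambda>w. (\<chi> i j. g_lo L i j w) $ i $ j) differentiable (at z)" for i j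
      using z by (simp add: smooth_g_lo)
  qed
  ultimately show ?thesis
    using differentiable_cong_open[OF open_U z] by (metis (no_types, lifting))
qed

text \<open>In \<open>spray_eq\<close> the inverse metric no longer occurs; this is its
  \<open>y\<close>-derivative. The factor 2 appears because \<open>nonlin_conn\<close> is half the
  derivative of the spray.\<close>

lemma nonlin_conn_eq:
  assumes z: "z \<in> U"
  shows "2 * (\<Sum>i\<in>UNIV. g_lo L r i z * nonlin_conn L i j z)
    = 1/2 * dx j (dy r Q) z - 1/2 * dx r (dy j Q) z + (\<Sum>k\<in>UNIV. snd z $ k * dx k (g_lo L r j) z)
      - (\<Sum>i\<in>UNIV. spray L i z * dy i (g_lo L r j) z)"
proof -
  have "dy j (\<lambda>w. \<Sum>i\<in>UNIV. g_lo L r i w * spray L i w) z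
      = dy j (\<lambda>w. 1/2 * ((\<Sum>k\<in>UNIV. snd w $ k * dx k (dy r Q) w) - dx r Q w)) z"
    by (rule dy_cong[OF open_U z])
       (use z in \<open>auto simp: spray_eq smooth_g_lo differentiable_spray\<close>)
  also have "\<dots> = 1/2 * (dx j (dy r Q) z + (\<Sum>k\<in>UNIV. snd z $ k * (2 * dx k (g_lo L r j) z)) - dx r (dy j Q) z)"
    using z dy_dx_commute[OF open_U smooth_U(2) z, of j r]
    by (simp add: dy_mult dy_diff dy_sum smooth_U_deriv sum.distrib dy_dx_dy_Q del: times_divide_eq_left)
  also have "dy j (\<lambda>w. \<Sum>i\<in>UNIV. g_lo L r i w * spray L i w) z
      = (\<Sum>i\<in>UNIV. spray L i z * dy j (g_lo L r i) z) + (\<Sum>i\<in>UNIV. g_lo L r i z * (2 * nonlin_conn L i j z))"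
    using z by (simp add: dy_sum dy_mult smooth_g_lo differentiable_spray sum.distrib nonlin_conn_def mult.commute)
  \<comment> \<open>Total symmetry moves the summation index into the derivative, the form in which
    \<open>delta\<close> produces this term.\<close>
  also have "(\<Sum>i\<in>UNIV. spray L i z * dy j (g_lo L r i) z) = (\<Sum>i\<in>UNIV. spray L i z * dy i (g_lo L r j) z)"
    using dy_g_lo_swap[OF z, of j r] dy_g_lo_swap[OF z, of _ r j] dy_g_lo_sym[OF z] by metis
  finally show ?thesis
    by (simp add: sum_distrib_left algebra_simps)
qed

text \<open>Euler's relation for the spray, homogeneous of degree two in \<open>y\<close>. It
  follows by contracting \<open>nonlin_conn_eq\<close> with \<open>y\<close> and using the
  contraction rules for the metric.\<close>

lemma nonlin_conn_contract:
  assumes z: "z \<in> U"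
  shows "(\<Sum>j\<in>UNIV. nonlin_conn L i j z * snd z $ j) = spray L i z"
proof (rule g_lo_cancel[OF z])
  fix r
  have "2 * (\<Sum>s\<in>UNIV. g_lo L r s z * (\<Sum>j\<in>UNIV. nonlin_conn L s j z * snd z $ j))
      = (\<Sum>j\<in>UNIV. snd z $ j * (2 * (\<Sum>s\<in>UNIV. g_lo L r s z * nonlin_conn L s j z)))"
    unfolding sum_distrib_left by (subst sum.swap) (simp add: algebra_simps)
  also have "\<dots> = 1/2 * (\<Sum>j\<in>UNIV. snd z $ j * dx j (dy r Q) z) - 1/2 * (\<Sum>j\<in>UNIV. snd z $ j * dx r (dy j Q) z)
      + (\<Sum>j\<in>UNIV. \<Sum>k\<in>UNIV. snd z $ j * (snd z $ k * dx k (g_lo L r j) z))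
      - (\<Sum>j\<in>UNIV. \<Sum>k\<in>UNIV. snd z $ j * (spray L k z * dy k (g_lo L r j) z))"
    unfolding nonlin_conn_eq[OF z]
    by (simp add: sum_distrib_left right_diff_distrib distrib_left sum.distrib sum_subtractf mult.left_commute
        del: times_divide_eq_left times_divide_eq_right)
  also have "(\<Sum>j\<in>UNIV. \<Sum>k\<in>UNIV. snd z $ j * (snd z $ k * dx k (g_lo L r j) z))
      = (\<Sum>k\<in>UNIV. snd z $ k * (\<Sum>j\<in>UNIV. snd z $ j * dx k (g_lo L r j) z))"
    unfolding sum_distrib_left by (subst sum.swap) (simp add: algebra_simps)
  also have "(\<Sum>j\<in>UNIV. \<Sum>k\<in>UNIV. snd z $ j * (spray L k z * dy k (g_lo L r j) z))
      = (\<Sum>k\<in>UNIV. spray L k z * (\<Sum>j\<in>UNIV. snd z $ j * dy k (g_lo L r j) z))"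
    unfolding sum_distrib_left by (subst sum.swap) (simp add: algebra_simps)
  finally show "(\<Sum>s\<in>UNIV. g_lo L r s z * (\<Sum>j\<in>UNIV. nonlin_conn L s j z * snd z $ j))
      = (\<Sum>s\<in>UNIV. g_lo L r s z * spray L s z)"
    by (simp add: spray_eq[OF z] dx_dQ_contract[OF z] dx_g_lo_contract[OF z] dy_g_lo_contract[OF z]
        sum_divide_distrib[symmetric])
qed

lemma cartan_coeff_sym:
  assumes z: "z \<in> U"
  shows "cartan_coeff L i j k z = cartan_coeff L i k j z"
proof -
  have "delta L r (g_lo L j k) z = delta L r (g_lo L k j) z" for r
    by (simp add: delta_def dx_g_lo_sym[OF z, of r j k] dy_g_lo_sym[OF z, of _ j k])
  then show ?thesis by (simp add: cartan_coeff_def add.commute)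
qed

text \<open>After lowering the index, the three \<open>delta\<close> terms contracted with
  \<open>y\<close> reproduce the right-hand side of \<open>nonlin_conn_eq\<close>.\<close>

lemma cartan_coeff_contract:
  assumes z: "z \<in> U"
  shows "(\<Sum>k\<in>UNIV. cartan_coeff L i j k z * snd z $ k) = nonlin_conn L i j z"
proof -
  \<comment> \<open>When \<open>y\<close> is contracted with an index of the metric, the vertical
    part of \<open>delta\<close> vanishes.\<close>
  have delta: "(\<Sum>k\<in>UNIV. snd z $ k * delta L j (g_lo L r k) z) = 1/2 * dx j (dy r Q) z" for j r
  proof -
    have "(\<Sum>k\<in>UNIV. snd z $ k * delta L j (g_lo L r k) z)
      = (\<Sum>k\<in>UNIV. snd z $ k * dx j (g_lo L r k) z)
        - (\<Sum>k\<in>UNIV. \<Sum>s\<in>UNIV. snd z $ k * (nonlin_conn L s j z * dy s (g_lo L r k) z))"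
      by (simp add: delta_def right_diff_distrib sum_subtractf sum_distrib_left)
    also have "(\<Sum>k\<in>UNIV. \<Sum>s\<in>UNIV. snd z $ k * (nonlin_conn L s j z * dy s (g_lo L r k) z))
      = (\<Sum>s\<in>UNIV. nonlin_conn L s j z * (\<Sum>k\<in>UNIV. snd z $ k * dy s (g_lo L r k) z))"
      unfolding sum_distrib_left by (subst sum.swap) (simp add: algebra_simps)
    finally show ?thesis by (simp add: dy_g_lo_contract[OF z] dx_g_lo_contract[OF z])
  qed
  \<comment> \<open>When \<open>y\<close> is contracted with the index of \<open>delta\<close>, the
    connection becomes the spray.\<close>
  have delta0: "(\<Sum>k\<in>UNIV. snd z $ k * delta L k f z)
      = (\<Sum>k\<in>UNIV. snd z $ k * dx k f z) - (\<Sum>s\<in>UNIV. spray L s z * dy s f z)" for f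
  proof -
    have "(\<Sum>k\<in>UNIV. snd z $ k * delta L k f z)
      = (\<Sum>k\<in>UNIV. snd z $ k * dx k f z)
        - (\<Sum>k\<in>UNIV. \<Sum>s\<in>UNIV. snd z $ k * (nonlin_conn L s k z * dy s f z))"
      by (simp add: delta_def right_diff_distrib sum_subtractf sum_distrib_left)
    also have "(\<Sum>k\<in>UNIV. \<Sum>s\<in>UNIV. snd z $ k * (nonlin_conn L s k z * dy s f z))
      = (\<Sum>s\<in>UNIV. (\<Sum>k\<in>UNIV. nonlin_conn L s k z * snd z $ k) * dy s f z)"
      unfolding sum_distrib_right by (subst sum.swap) (simp add: algebra_simps)
    finally show ?thesis by (simp add: nonlin_conn_contract[OF z])
  qed
  have "(\<Sum>k\<in>UNIV. cartan_coeff L i j k z * snd z $ k)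
    = (\<Sum>r\<in>UNIV. g_up L i r z * (1/2 * (\<Sum>k\<in>UNIV. snd z $ k *
     (delta L j (g_lo L r k) z + delta L k (g_lo L r j) z - delta L r (g_lo L j k) z))))"
    unfolding cartan_coeff_def sum_distrib_left sum_distrib_right
    by (subst sum.swap) (simp add: algebra_simps)
  also have "\<dots> = (\<Sum>r\<in>UNIV. g_up L i r z * (\<Sum>s\<in>UNIV. g_lo L r s z * nonlin_conn L s j z))"
  proof (intro sum.cong refl arg_cong2[where f = "(*)"])
    fix r
    show "1/2 * (\<Sum>k\<in>UNIV. snd z $ k *
       (delta L j (g_lo L r k) z + delta L k (g_lo L r j) z - delta L r (g_lo L j k) z))
      = (\<Sum>s\<in>UNIV. g_lo L r s z * nonlin_conn L s j z)"
      using nonlin_conn_eq[OF z, of r j]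
      by (simp add: right_diff_distrib distrib_left sum.distrib sum_subtractf delta delta0)
  qed
  finally show ?thesis by (simp add: g_up_sum_g_lo[OF z])
qed

section \<open>From \<open>Q\<close> to \<open>L\<close>: the Euler--Lagrange equations for the
  metric function\<close>

lemma
  assumes z: "z \<in> U"
  shows g_lo_eq: "g_lo L i j z = L_1 L i z * L_1 L j z + L z * L_2 L i j z"
    and L_2_sym: "L_2 L i j z = L_2 L j i z"
    and g_up_L_1: "(\<Sum>r\<in>UNIV. g_up L i r z * L_1 L r z) = L_up L i z"
proof -
  have "dy i (dy j Q) z = dy i (\<lambda>w. 2 * L w * dy j L w) z"
    by (rule dy_cong[OF open_U z]) (use z in \<open>auto simp: dy_Q smooth_U_deriv\<close>)
  then show "g_lo L i j z = L_1 L i z * L_1 L j z + L z * L_2 L i j z"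
    using z dy_dy_commute[OF open_U smooth_U(1) z, of i j]
    by (simp add: g_lo_def L_1_def L_2_def dy_mult smooth_U_deriv algebra_simps)
  show "L_2 L i j z = L_2 L j i z"
    using z dy_dy_commute[OF open_U smooth_U(1) z] by (simp add: L_1_def L_2_def)
  have "L z > 0" using L_pos z by (simp add: U_def)
  \<comment> \<open>Lowering the index of \<open>y\<close> gives \<open>L z * L_1 L r z\<close>;
    raising it again yields the third claim.\<close>
  have "(\<Sum>s\<in>UNIV. g_lo L r s z * snd z $ s) = L z * L_1 L r z" for r
    using g_lo_contract[OF z, of r] dy_Q[OF z, of r] by (simp add: L_1_def mult.commute)
  then have "(\<Sum>r\<in>UNIV. g_up L i r z * (L z * L_1 L r z)) = snd z $ i"
    using g_up_sum_g_lo[OF z, of i "\<lambda>s. snd z $ s"] by simp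
  then have "L z * (\<Sum>r\<in>UNIV. g_up L i r z * L_1 L r z) = snd z $ i"
    by (simp add: sum_distrib_left mult.left_commute)
  then show "(\<Sum>r\<in>UNIV. g_up L i r z * L_1 L r z) = L_up L i z"
    using \<open>L z > 0\<close> by (simp add: L_up_def field_simps)
qed

text \<open>Since \<open>L_1\<close> is \<open>y\<close> with lowered index divided by
  \<open>L\<close>, this is \<open>spray_eq\<close> contracted with \<open>y\<close>. It expresses
  that \<open>L\<close> is constant along geodesics.\<close>

lemma L_1_spray:
  assumes z: "z \<in> U"
  shows "(\<Sum>r\<in>UNIV. L_1 L r z * spray L r z) = (\<Sum>k\<in>UNIV. snd z $ k * dx k L z)"
proof -
  have "L z * (\<Sum>r\<in>UNIV. L_1 L r z * spray L r z) = (\<Sum>r\<in>UNIV. (1/2 * dy r Q z) * spray L r z)"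
    by (simp add: dy_Q[OF z] L_1_def sum_distrib_left algebra_simps)
  also have "\<dots> = (\<Sum>i\<in>UNIV. \<Sum>j\<in>UNIV. snd z $ j * g_lo L i j z * spray L i z)"
    by (simp only: g_lo_contract[OF z, symmetric] sum_distrib_right)
  also have "\<dots> = (\<Sum>j\<in>UNIV. snd z $ j * (\<Sum>i\<in>UNIV. g_lo L j i z * spray L i z))"
    by (subst sum.swap) (simp add: sum_distrib_left g_lo_sym[OF z] mult.assoc)
  also have "\<dots> = 1/2 * ((\<Sum>j\<in>UNIV. \<Sum>k\<in>UNIV. snd z $ j * (snd z $ k * dx k (dy j Q) z)) - (\<Sum>j\<in>UNIV. snd z $ j * dx j Q z))"
    unfolding spray_eq[OF z]
    by (simp add: sum_distrib_left right_diff_distrib sum_subtractf del: times_divide_eq_left times_divide_eq_right)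
       (simp add: algebra_simps)
  also have "(\<Sum>j\<in>UNIV. \<Sum>k\<in>UNIV. snd z $ j * (snd z $ k * dx k (dy j Q) z))
      = (\<Sum>k\<in>UNIV. snd z $ k * (\<Sum>j\<in>UNIV. snd z $ j * dx k (dy j Q) z))"
    unfolding sum_distrib_left by (subst sum.swap) (simp add: algebra_simps)
  also have "\<dots> = 2 * (\<Sum>k\<in>UNIV. snd z $ k * dx k Q z)"
    by (simp add: dx_dQ_contract[OF z] sum_distrib_left algebra_simps)
  finally have "L z * (\<Sum>r\<in>UNIV. L_1 L r z * spray L r z) = 1/2 * (\<Sum>k\<in>UNIV. snd z $ k * dx k Q z)"
    by simp
  then have "L z * (\<Sum>r\<in>UNIV. L_1 L r z * spray L r z) = L z * (\<Sum>k\<in>UNIV. snd z $ k * dx k L z)"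
    by (simp add: dx_Q[OF z] sum_distrib_left algebra_simps)
  moreover have "L z > 0" using L_pos z by (simp add: U_def)
  ultimately show ?thesis by simp
qed

text \<open>In \<open>spray_eq\<close> the metric is split by \<open>g_lo_eq\<close>; the rank-one
  part is removed with \<open>L_1_spray\<close>, and a factor \<open>L z\<close> cancels.\<close>

lemma L_2_spray:
  assumes z: "z \<in> U"
  shows "(\<Sum>r\<in>UNIV. L_2 L i r z * spray L r z) = (\<Sum>k\<in>UNIV. snd z $ k * dx k (L_1 L i) z) - dx i L z"
proof -
  have *: "dx k (dy i Q) z = 2 * (dx k L z * L_1 L i z + L z * dx k (L_1 L i) z)" for k
  proof -
    have "dx k (dy i Q) z = dx k (\<lambda>w. 2 * (L w * dy i L w)) z"
      by (rule dx_cong[OF open_U z]) (use z in \<open>auto simp: dy_Q smooth_U_deriv\<close>)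
    then show ?thesis
      using z by (simp add: dx_mult smooth_U_deriv L_1_def)
  qed
  have "(\<Sum>r\<in>UNIV. g_lo L i r z * spray L r z)
      = L_1 L i z * (\<Sum>r\<in>UNIV. L_1 L r z * spray L r z) + L z * (\<Sum>r\<in>UNIV. L_2 L i r z * spray L r z)"
    by (simp add: g_lo_eq[OF z] distrib_right sum.distrib sum_distrib_left mult.assoc)
  moreover have "(\<Sum>k\<in>UNIV. snd z $ k * dx k (dy i Q) z)
      = 2 * (L_1 L i z * (\<Sum>k\<in>UNIV. snd z $ k * dx k L z) + L z * (\<Sum>k\<in>UNIV. snd z $ k * dx k (L_1 L i) z))"
    by (simp add: * sum_distrib_left algebra_simps sum.distrib)
  ultimately have "L z * (\<Sum>r\<in>UNIV. L_2 L i r z * spray L r z)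
      = L z * ((\<Sum>k\<in>UNIV. snd z $ k * dx k (L_1 L i) z) - dx i L z)"
    using spray_eq[OF z, of i] by (simp add: L_1_spray[OF z] dx_Q[OF z] algebra_simps)
  moreover have "L z > 0" using L_pos z by (simp add: U_def)
  ultimately show ?thesis by simp
qed

end

section \<open>The change of metric in one chart\<close>

text \<open>Both metrics are treated as Finsler functions over the same \<open>X\<close>, so the
  facts above hold for each and the set \<open>U\<close> is common. That \<sigma> and \<beta> depend
  on \<open>x\<close> alone is built into their types.\<close>

locale beta_conformal_chart = finsler_chart X L + bar: finsler_chart X L'
  for X :: "(real ^ 'n::finite) set" and L L' :: "'n fld" +
  fixes \<sigma> :: "real ^ 'n \<Rightarrow> real" and \<beta> :: "'n \<Rightarrow> real ^ 'n \<Rightarrow> real"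
  assumes smooth_\<sigma>: "smooth_on X \<sigma>"
    and smooth_\<beta>: "smooth_on X (\<beta> i)"
    and change: "z \<in> X \<times> - {0} \<Longrightarrow> L' z = exp (\<sigma> (fst z)) * L z + (\<Sum>i\<in>UNIV. \<beta> i (fst z) * snd z $ i)"
begin

abbreviation s :: "'n fld" where "s \<equiv> \<lambda>z. \<sigma> (fst z)"
abbreviation b :: "'n \<Rightarrow> 'n fld" where "b \<equiv> \<lambda>i z. \<beta> i (fst z)"

lemma smooth_L_1: "smooth_on U (L_1 L i)" and smooth_L_2: "smooth_on U (L_2 L i j)"
  by (simp_all add: L_1_def L_2_def smooth_U_deriv)

text \<open>Over the open set \<open>U\<close> the \<open>x\<close>-derivative of a function of
  \<open>x\<close> is again a function of \<open>x\<close>, so its \<open>y\<close>-derivatives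
  vanish too.\<close>

lemma base_function:
  assumes h: "smooth_on X h" and z: "z \<in> U"
  shows "(\<lambda>w. h (fst w)) differentiable (at z)" and "dy j (\<lambda>w. h (fst w)) z = 0"
    and "dx k (\<lambda>w. h (fst w)) differentiable (at z)" and "dy j (dx k (\<lambda>w. h (fst w))) z = 0"
proof -
  have X: "fst w \<in> X" if "w \<in> U" for w using that by (auto simp: U_def)
  show "(\<lambda>w. h (fst w)) differentiable (at z)" "dy j (\<lambda>w. h (fst w)) z = 0"
    using base_derivatives[OF open_X h X[OF z]] by auto
  let ?h = "\<lambda>x. frechet_derivative h (at x) (axis k 1)"
  have eq: "?h (fst w) = dx k (\<lambda>w. h (fst w)) w" if "w \<in> U" for w
    using dx_base[OF open_X h X[OF that]] by simp
  note d = base_derivatives[OF open_X smooth_on_frechet_derivative[OF h, of "axis k 1"] X[OF z]]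
  show "dx k (\<lambda>w. h (fst w)) differentiable (at z)"
    by (rule differentiable_cong_open[OF open_U z d(3) eq])
  show "dy j (dx k (\<lambda>w. h (fst w))) z = 0"
    using dy_cong[OF open_U z d(3) eq, of j] d(1) by simp
qed

lemmas base_function_\<sigma> [simp] = base_function[OF smooth_\<sigma>]
lemmas base_function_\<beta> [simp] = base_function[OF smooth_\<beta>]

lemma change_U: "z \<in> U \<Longrightarrow> L' z = exp (s z) * L z + (\<Sum>i\<in>UNIV. b i z * snd z $ i)"
  using change by (simp add: U_def)

lemma L_pos_U: "z \<in> U \<Longrightarrow> L z > 0" "z \<in> U \<Longrightarrow> L' z > 0"
  using L_pos bar.L_pos by (simp_all add: U_def)

section \<open>Derivatives of the changed metric function\<close>

lemma
  assumes z: "z \<in> U"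
  shows L_1_change: "L_1 L' i z = exp (s z) * L_1 L i z + b i z"
    and dx_change: "dx i L' z = exp (s z) * (s_lo s i z * L z + dx i L z) + (\<Sum>j\<in>UNIV. dx i (b j) z * snd z $ j)"
proof -
  have "dy i L' z = dy i (\<lambda>z. exp (s z) * L z + (\<Sum>i\<in>UNIV. b i z * snd z $ i)) z"
    by (rule dy_cong[OF open_U z]) (use z bar.smooth_U in \<open>auto simp: change_U\<close>)
  then show "L_1 L' i z = exp (s z) * L_1 L i z + b i z"
    using z by (simp add: L_1_def dy_add dy_mult dy_sum dy_exp smooth_U)
  have "dx i L' z = dx i (\<lambda>z. exp (s z) * L z + (\<Sum>i\<in>UNIV. b i z * snd z $ i)) z"
    by (rule dx_cong[OF open_U z]) (use z bar.smooth_U in \<open>auto simp: change_U\<close>)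
  then show "dx i L' z = exp (s z) * (s_lo s i z * L z + dx i L z) + (\<Sum>j\<in>UNIV. dx i (b j) z * snd z $ j)"
    using z by (simp add: s_lo_def dx_add dx_mult dx_sum dx_exp smooth_U algebra_simps)
qed

text \<open>The 1-form is linear in \<open>y\<close> and drops out of the second
  \<open>y\<close>-derivatives, so the Euler--Lagrange equations of both metrics have proportional
  coefficient matrices.\<close>

lemma
  assumes z: "z \<in> U"
  shows L_2_change: "L_2 L' i j z = exp (s z) * L_2 L i j z"
    and dx_L_1_change: "dx k (L_1 L' i) z
      = exp (s z) * (s_lo s k z * L_1 L i z + dx k (L_1 L i) z) + dx k (b i) z"
proof -
  have *: "L_1 L' i differentiable (at z)"
    using z bar.smooth_U by (simp add: L_1_def smooth_on_dy)
  have "dy j (L_1 L' i) z = dy j (\<lambda>z. exp (s z) * L_1 L i z + b i z) z"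
    by (rule dy_cong[OF open_U z *]) (rule L_1_change)
  then show "L_2 L' i j z = exp (s z) * L_2 L i j z"
    using z by (simp add: L_2_def dy_add dy_mult dy_exp smooth_L_1)
  have "dx k (L_1 L' i) z = dx k (\<lambda>z. exp (s z) * L_1 L i z + b i z) z"
    by (rule dx_cong[OF open_U z *]) (rule L_1_change)
  then show "dx k (L_1 L' i) z = exp (s z) * (s_lo s k z * L_1 L i z + dx k (L_1 L i) z) + dx k (b i) z"
    using z by (simp add: s_lo_def dx_add dx_mult dx_exp smooth_L_1 algebra_simps)
qed

section \<open>Covariant derivatives of the 1-form\<close>

lemma b_cov_eq:
  assumes z: "z \<in> U"
  shows "b_cov L b i j z = dx j (b i) z - (\<Sum>r\<in>UNIV. b r z * cartan_coeff L r i j z)"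
  using z by (simp add: b_cov_def delta_def)

text \<open>The connection terms cancel by symmetry; up to the factor -1/2 this is the exterior
  derivative of the 1-form.\<close>

lemma F_lo_eq:
  assumes z: "z \<in> U"
  shows "F_lo L b i j z = 1/2 * (dx j (b i) z - dx i (b j) z)"
  by (simp add: F_lo_def b_cov_eq[OF z] cartan_coeff_sym[OF z, of _ i j])

text \<open>The Cartan coefficients enter only contracted with \<open>y\<close>, where they reduce
  to the nonlinear connection.\<close>

lemma E_0_eq:
  assumes z: "z \<in> U"
  shows "2 * E_0 L b j z = (\<Sum>k\<in>UNIV. (dx k (b j) z + dx j (b k) z) * snd z $ k)
    - 2 * (\<Sum>r\<in>UNIV. b r z * nonlin_conn L r j z)"
proof -
  have "2 * E_0 L b j z = (\<Sum>k\<in>UNIV. (dx k (b j) z + dx j (b k) z) * snd z $ k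
      - 2 * ((\<Sum>r\<in>UNIV. b r z * cartan_coeff L r j k z) * snd z $ k))"
    by (simp add: E_0_def E_lo_def b_cov_eq[OF z] cartan_coeff_sym[OF z, of _ _ j] sum_distrib_left
        algebra_simps)
  also have "\<dots> = (\<Sum>k\<in>UNIV. (dx k (b j) z + dx j (b k) z) * snd z $ k)
      - 2 * (\<Sum>r\<in>UNIV. b r z * (\<Sum>k\<in>UNIV. cartan_coeff L r j k z * snd z $ k))"
    unfolding sum_subtractf sum_distrib_left sum_distrib_right
    by (subst (2) sum.swap) (simp add: mult.assoc)
  finally show ?thesis by (simp add: cartan_coeff_contract[OF z])
qed

lemma E_00_eq:
  assumes z: "z \<in> U"
  shows "E_00 L b z = (\<Sum>i\<in>UNIV. snd z $ i * (\<Sum>k\<in>UNIV. snd z $ k * dx k (b i) z))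
    - (\<Sum>r\<in>UNIV. b r z * spray L r z)"
proof -
  have "E_00 L b z = (\<Sum>j\<in>UNIV. E_0 L b j z * snd z $ j)"
    unfolding E_00_def E_0_def sum_distrib_right by (subst sum.swap) simp
  then have "2 * E_00 L b z = (\<Sum>j\<in>UNIV. (2 * E_0 L b j z) * snd z $ j)"
    by (simp add: sum_distrib_left mult.assoc)
  also have "\<dots> = (\<Sum>j\<in>UNIV. \<Sum>k\<in>UNIV. dx k (b j) z * snd z $ k * snd z $ j)
      + (\<Sum>j\<in>UNIV. \<Sum>k\<in>UNIV. dx j (b k) z * snd z $ k * snd z $ j)
      - 2 * (\<Sum>j\<in>UNIV. \<Sum>r\<in>UNIV. b r z * nonlin_conn L r j z * snd z $ j)"
    unfolding E_0_eq[OF z]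
    by (simp add: left_diff_distrib distrib_right sum.distrib sum_subtractf sum_distrib_left sum_distrib_right mult.assoc)
  also have "(\<Sum>j\<in>UNIV. \<Sum>k\<in>UNIV. dx j (b k) z * snd z $ k * snd z $ j)
      = (\<Sum>j\<in>UNIV. \<Sum>k\<in>UNIV. dx k (b j) z * snd z $ k * snd z $ j)"
    by (subst sum.swap) (simp add: algebra_simps)
  also have "(\<Sum>j\<in>UNIV. \<Sum>r\<in>UNIV. b r z * nonlin_conn L r j z * snd z $ j)
      = (\<Sum>r\<in>UNIV. b r z * (\<Sum>j\<in>UNIV. nonlin_conn L r j z * snd z $ j))"
    unfolding sum_distrib_left by (subst sum.swap) (simp add: mult.assoc)
  finally have "E_00 L b z = (\<Sum>j\<in>UNIV. \<Sum>k\<in>UNIV. dx k (b j) z * snd z $ k * snd z $ j)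
      - (\<Sum>r\<in>UNIV. b r z * spray L r z)"
    by (simp add: nonlin_conn_contract[OF z])
  then show ?thesis
    by (simp add: sum_distrib_left algebra_simps)
qed

text \<open>The two equations below determine a vector \<open>V\<close>: the first leaves open only its component
  along \<open>y\<close>, which the second one fixes.\<close>

lemma linear_system_solution:
  assumes z: "z \<in> U"
    and T: "\<And>i. (\<Sum>r\<in>UNIV. L_2 L i r z * V r) = T i"
    and K: "(\<Sum>r\<in>UNIV. L_1 L' r z * V r) = K"
  shows "V i = L z * (\<Sum>r\<in>UNIV. g_up L i r z * T r)
    + L z / L' z * (K - L z * (\<Sum>r\<in>UNIV. b_up L b r z * T r)) * L_up L i z"
proof -
  \<comment> \<open>\<open>l\<close> is the unknown component along \<open>y\<close>. Adding
    \<open>l * L_1 L k z\<close> to the degenerate system completes \<open>L_2\<close> to the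
    invertible \<open>g_lo\<close>.\<close>
  define l where "l = (\<Sum>r\<in>UNIV. L_1 L r z * V r)"
  have "(\<Sum>r\<in>UNIV. g_lo L k r z * V r) = l * L_1 L k z + L z * T k" for k
    by (simp add: g_lo_eq[OF z] distrib_right sum.distrib l_def T[symmetric] sum_distrib_left sum_distrib_right algebra_simps)
  then have V: "V k = l * L_up L k z + L z * (\<Sum>r\<in>UNIV. g_up L k r z * T r)" for k
    using g_up_sum_g_lo[OF z, of k V] g_up_L_1[OF z, of k]
    by (simp add: distrib_left sum.distrib mult.left_commute flip: sum_distrib_left)
  have bT: "(\<Sum>k\<in>UNIV. b k z * (\<Sum>r\<in>UNIV. g_up L k r z * T r)) = (\<Sum>r\<in>UNIV. b_up L b r z * T r)"
    unfolding b_up_def sum_distrib_left sum_distrib_right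
    by (subst sum.swap) (simp add: g_up_sym[OF z] algebra_simps)
  \<comment> \<open>Substituting \<open>V\<close> into the second equation leaves one linear
    equation for \<open>l\<close>; its coefficient \<open>exp (s z) + q\<close> is
    \<open>L' z / L z\<close>, which is positive.\<close>
  define p q where "p = (\<Sum>r\<in>UNIV. b_up L b r z * T r)" and "q = (\<Sum>k\<in>UNIV. b k z * L_up L k z)"
  have "(\<Sum>k\<in>UNIV. b k z * V k) = l * q + L z * p"
    unfolding V p_def bT[symmetric] q_def
    by (simp add: distrib_left sum.distrib sum_distrib_left mult.left_commute)
  moreover have "K = exp (s z) * l + (\<Sum>k\<in>UNIV. b k z * V k)"
    by (simp add: K[symmetric] L_1_change[OF z] l_def distrib_right sum.distrib sum_distrib_left mult.assoc)
  moreover have "L' z = exp (s z) * L z + L z * q"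
    using L_pos_U(1)[OF z] by (simp add: change_U[OF z] L_up_def sum_distrib_left q_def)
  ultimately have "L z * (K - L z * p) = l * L' z"
    by (simp add: algebra_simps)
  then have "l = L z / L' z * (K - L z * p)"
    using L_pos_U[OF z] by (simp add: field_simps)
  then show ?thesis using V[of i] by (simp add: p_def)
qed

section \<open>The difference of the sprays\<close>

definition spray_diff where "spray_diff r z = spray L' r z - spray L r z"

text \<open>\<open>L_2_spray\<close> for \<open>L'\<close>, expressed through \<open>L\<close>,
  minus \<open>exp (s z)\<close> times \<open>L_2_spray\<close> for \<open>L\<close>. The
  derivatives of \<open>b\<close> survive only in antisymmetrized form.\<close>

lemma L_2_spray_diff:
  assumes z: "z \<in> U"
  shows "(\<Sum>r\<in>UNIV. L_2 L i r z * spray_diff r z)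
    = 2 * exp (- s z) * F_0 L b i z + s_0 s z * L_1 L i z - s_lo s i z * L z"
proof -
  have "exp (s z) * (\<Sum>r\<in>UNIV. L_2 L i r z * spray L' r z)
      = (\<Sum>k\<in>UNIV. snd z $ k * dx k (L_1 L' i) z) - dx i L' z"
    using bar.L_2_spray[OF z, of i] by (simp add: L_2_change[OF z] sum_distrib_left mult.assoc)
  also have "\<dots> = exp (s z) * (s_0 s z * L_1 L i z + (\<Sum>k\<in>UNIV. snd z $ k * dx k (L_1 L i) z)
      - s_lo s i z * L z - dx i L z) + 2 * F_0 L b i z"
    unfolding dx_L_1_change[OF z] dx_change[OF z] F_0_def F_lo_eq[OF z] s_0_def
    by (simp add: sum_distrib_left sum_distrib_right algebra_simps sum.distrib sum_subtractf)
  also have "(\<Sum>k\<in>UNIV. snd z $ k * dx k (L_1 L i) z) = (\<Sum>r\<in>UNIV. L_2 L i r z * spray L r z) + dx i L z"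
    by (simp add: L_2_spray[OF z])
  finally have "exp (s z) * (\<Sum>r\<in>UNIV. L_2 L i r z * spray_diff r z)
      = exp (s z) * (s_0 s z * L_1 L i z - s_lo s i z * L z) + 2 * F_0 L b i z"
    by (simp add: spray_diff_def right_diff_distrib sum_subtractf algebra_simps)
  then show ?thesis by (simp add: exp_minus field_simps)
qed

text \<open>The same subtraction for \<open>L_1_spray\<close>. The \<open>b\<close>-part of
  \<open>L_1 L'\<close>, contracted with the old spray, completes the partial derivatives of
  \<open>b\<close> to \<open>E_00\<close>.\<close>

lemma L_1_spray_diff:
  assumes z: "z \<in> U"
  shows "(\<Sum>r\<in>UNIV. L_1 L' r z * spray_diff r z) = exp (s z) * s_0 s z * L z + E_00 L b z"
proof -
  have "(\<Sum>r\<in>UNIV. L_1 L' r z * spray L' r z)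
      = exp (s z) * (s_0 s z * L z + (\<Sum>k\<in>UNIV. snd z $ k * dx k L z))
        + (\<Sum>k\<in>UNIV. \<Sum>i\<in>UNIV. snd z $ k * (dx k (b i) z * snd z $ i))"
    unfolding bar.L_1_spray[OF z] dx_change[OF z] s_0_def
    by (simp add: sum_distrib_left sum_distrib_right algebra_simps sum.distrib)
  also have "(\<Sum>k\<in>UNIV. \<Sum>i\<in>UNIV. snd z $ k * (dx k (b i) z * snd z $ i))
      = (\<Sum>i\<in>UNIV. snd z $ i * (\<Sum>k\<in>UNIV. snd z $ k * dx k (b i) z))"
    unfolding sum_distrib_left by (subst sum.swap) (simp add: algebra_simps)
  also have "(\<Sum>k\<in>UNIV. snd z $ k * dx k L z) = (\<Sum>r\<in>UNIV. L_1 L r z * spray L r z)"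
    by (simp add: L_1_spray[OF z])
  finally have "(\<Sum>r\<in>UNIV. L_1 L' r z * spray L' r z)
      = exp (s z) * (s_0 s z * L z) + (\<Sum>r\<in>UNIV. L_1 L' r z * spray L r z) + E_00 L b z"
    by (simp add: E_00_eq[OF z] L_1_change[OF z] distrib_right sum.distrib sum_distrib_left algebra_simps)
  then show ?thesis
    by (simp add: spray_diff_def right_diff_distrib sum_subtractf)
qed

text \<open>\<open>linear_system_solution\<close> solves the two preceding equations; the rest
  brings its formula into the shape of \<open>D_00\<close>.\<close>

lemma D_00_eq:
  assumes z: "z \<in> U"
  shows "D_00 L L' s b r z = spray_diff r z"
proof -
  define T where "T i = 2 * exp (- s z) * F_0 L b i z + s_0 s z * L_1 L i z - s_lo s i z * L z" for i
  have gT: "(\<Sum>i\<in>UNIV. g_up L r i z * T i)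
      = 2 * exp (- s z) * F_up_0 L b r z + s_0 s z * L_up L r z - L z * s_up L s r z"
    unfolding T_def F_up_0_def s_up_def g_up_L_1[OF z, symmetric] g_up_sym[OF z, of _ r]
    by (simp add: right_diff_distrib distrib_left sum.distrib sum_subtractf sum_distrib_left algebra_simps)
  \<comment> \<open>Moving the inverse metric from \<open>b\<close> to \<open>L_1\<close> gives the
    1-form at \<open>y\<close> divided by \<open>L\<close>, and the 1-form is
    \<open>L' - exp (s z) * L\<close>.\<close>
  have "(\<Sum>i\<in>UNIV. b_up L b i z * L_1 L i z) = (\<Sum>i\<in>UNIV. b i z * L_up L i z)"
    unfolding b_up_def g_up_L_1[OF z, symmetric] sum_distrib_left sum_distrib_right
    by (subst sum.swap) (simp add: g_up_sym[OF z] algebra_simps)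
  also have "\<dots> = (L' z - exp (s z) * L z) / L z"
    by (simp add: change_U[OF z] L_up_def sum_divide_distrib)
  finally have bL: "L z * (\<Sum>i\<in>UNIV. b_up L b i z * L_1 L i z) = L' z - exp (s z) * L z"
    using L_pos_U(1)[OF z] by simp
  have bT: "(\<Sum>i\<in>UNIV. b_up L b i z * T i)
      = 2 * exp (- s z) * F_beta_0 L b z + s_0 s z * (\<Sum>i\<in>UNIV. b_up L b i z * L_1 L i z) - L z * s_beta L s b z"
    unfolding T_def F_beta_0_def s_beta_def
    by (simp add: right_diff_distrib distrib_left sum.distrib sum_subtractf sum_distrib_left algebra_simps)
  have "L z * (\<Sum>i\<in>UNIV. b_up L b i z * T i)
      = 2 * L z * exp (- s z) * F_beta_0 L b z + s_0 s z * (L' z - exp (s z) * L z) - (L z)\<^sup>2 * s_beta L s b z"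
    unfolding bT bL[symmetric] by (simp add: algebra_simps power2_eq_square)
  \<comment> \<open>With the quotient kept as an opaque \<open>q\<close>, the comparison becomes a
    polynomial identity.\<close>
  moreover define q where "q = L z / L' z"
  ultimately have eq: "spray_diff r z = L z * (2 * exp (- s z) * F_up_0 L b r z + s_0 s z * L_up L r z - L z * s_up L s r z)
     + q * (exp (s z) * s_0 s z * L z + E_00 L b z
        - (2 * L z * exp (- s z) * F_beta_0 L b z + s_0 s z * (L' z - exp (s z) * L z) - (L z)\<^sup>2 * s_beta L s b z)) * L_up L r z"
    using linear_system_solution[OF z, of "\<lambda>r. spray_diff r z" T, OF _ L_1_spray_diff[OF z], of r] L_2_spray_diff[OF z]
    unfolding gT T_def[symmetric] by simp
  \<comment> \<open>The two formulas differ only in the multiple of \<open>s_0\<close>, and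
    \<open>L z - q * L' z\<close> is zero.\<close>
  have "D_00 L L' s b r z = spray_diff r z - (L z - q * L' z) * s_0 s z * L_up L r z"
    unfolding D_00_def eq q_def[symmetric] by (simp add: algebra_simps power2_eq_square)
  then show ?thesis
    using L_pos_U(2)[OF z] by (simp add: q_def)
qed

section \<open>The difference of the nonlinear connections\<close>

lemma differentiable_spray_diff: "z \<in> U \<Longrightarrow> spray_diff r differentiable (at z)"
  unfolding spray_diff_def[abs_def] by (simp add: differentiable_spray bar.differentiable_spray)

lemma dy_spray_diff: "z \<in> U \<Longrightarrow> dy j (spray_diff r) z = 2 * (nonlin_conn L' r j z - nonlin_conn L r j z)"
  unfolding spray_diff_def[abs_def]
  by (simp add: nonlin_conn_def dy_diff differentiable_spray bar.differentiable_spray)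

lemma differentiable_s_0: "z \<in> U \<Longrightarrow> s_0 s differentiable (at z)"
  and dy_s_0: "z \<in> U \<Longrightarrow> dy j (s_0 s) z = s_lo s j z"
  unfolding s_0_def[abs_def] s_lo_def by (simp_all add: dy_sum dy_mult)

text \<open>The \<open>y\<close>-derivative of \<open>L_2_spray_diff\<close>, halved. Where the
  derivative falls on \<open>L_2\<close> it yields the \<open>L_3\<close> term of
  \<open>G_2\<close>.\<close>

lemma L_2_nonlin_conn:
  assumes z: "z \<in> U"
  shows "(\<Sum>r\<in>UNIV. L_2 L i r z * (nonlin_conn L' r j z - nonlin_conn L r j z)) = G_2 L L' s b i j z"
proof -
  \<comment> \<open>\<open>F\<close> is \<open>F_0\<close> written with partial derivatives of
    \<open>b\<close>; in this form it is visibly linear in \<open>y\<close>.\<close>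
  define F where "F w = (\<Sum>k\<in>UNIV. 1/2 * (dx k (b i) w - dx i (b k) w) * snd w $ k)" for w
  have F: "F differentiable (at z)" "dy j F z = F_lo L b i j z"
    unfolding F_def[abs_def] using z by (simp_all add: dy_sum dy_mult dy_diff F_lo_eq del: times_divide_eq_left)
  have L_3: "L_3 L i j r z = dy j (L_2 L i r) z" for r
    unfolding L_3_def L_2_def by (rule dy_dy_commute[OF open_U smooth_L_1 z])
  have "dy j (\<lambda>w. \<Sum>r\<in>UNIV. L_2 L i r w * spray_diff r w) z
      = dy j (\<lambda>w. 2 * exp (- s w) * F w + s_0 s w * L_1 L i w - s_lo s i w * L w) z"
    by (rule dy_cong[OF open_U z])
       (use z in \<open>auto simp: L_2_spray_diff smooth_L_2 differentiable_spray_diff F_def F_0_def F_lo_eq\<close>)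
  also have "\<dots> = 2 * exp (- s z) * F_lo L b i j z + s_lo s j z * L_1 L i z + s_0 s z * L_2 L i j z
      - s_lo s i z * L_1 L j z"
    using z F by (simp add: dy_diff dy_add dy_mult dy_exp dy_minus differentiable_s_0 dy_s_0 smooth_L_1 smooth_U
        s_lo_def L_2_def L_1_def smooth_U_deriv)
  also have "dy j (\<lambda>w. \<Sum>r\<in>UNIV. L_2 L i r w * spray_diff r w) z
      = (\<Sum>r\<in>UNIV. L_3 L i j r z * spray_diff r z)
        + 2 * (\<Sum>r\<in>UNIV. L_2 L i r z * (nonlin_conn L' r j z - nonlin_conn L r j z))"
    using z by (simp add: dy_sum dy_mult smooth_L_2 differentiable_spray_diff dy_spray_diff L_3 sum.distrib
        sum_subtractf sum_distrib_left algebra_simps)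
  finally show ?thesis
    by (simp add: G_2_def D_00_eq[OF z] mu_def algebra_simps)
qed

text \<open>The \<open>y\<close>-derivative of \<open>L_1_spray_diff\<close>, halved. Where the
  derivative falls on \<open>L_1 L'\<close> it yields \<open>exp (s z)\<close> times the
  \<open>L_2\<close> term of \<open>G_1\<close>.\<close>

lemma L_1_nonlin_conn:
  assumes z: "z \<in> U"
  shows "(\<Sum>r\<in>UNIV. L_1 L' r z * (nonlin_conn L' r j z - nonlin_conn L r j z)) = G_1 L L' s b j z"
proof -
  \<comment> \<open>By \<open>E_00_eq\<close>, \<open>E_00\<close> is \<open>W - B\<close>;
    differentiating these two terms produces \<open>2 * E_0\<close> in the form of
    \<open>E_0_eq\<close>.\<close>
  define W where "W w = (\<Sum>i\<in>UNIV. snd w $ i * (\<Sum>k\<in>UNIV. snd w $ k * dx k (b i) w))" for w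
  define B where "B w = (\<Sum>r\<in>UNIV. b r w * spray L r w)" for w
  have W: "W differentiable (at z)" "dy j W z = (\<Sum>k\<in>UNIV. (dx k (b j) z + dx j (b k) z) * snd z $ k)"
    unfolding W_def[abs_def] using z by (simp_all add: dy_sum dy_mult sum.distrib algebra_simps)
  have B: "B differentiable (at z)" "dy j B z = 2 * (\<Sum>r\<in>UNIV. b r z * nonlin_conn L r j z)"
    unfolding B_def[abs_def] using z
    by (simp_all add: dy_sum dy_mult differentiable_spray nonlin_conn_def sum_distrib_left)
  have L1: "L_1 L' i differentiable (at z)" for i
    using z bar.smooth_U by (simp add: L_1_def smooth_on_dy)
  have "dy j (\<lambda>w. \<Sum>r\<in>UNIV. L_1 L' r w * spray_diff r w) z
      = dy j (\<lambda>w. exp (s w) * s_0 s w * L w + (W w - B w)) z"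
    by (rule dy_cong[OF open_U z])
       (use z L1 in \<open>auto simp: L_1_spray_diff differentiable_spray_diff W_def B_def E_00_eq\<close>)
  also have "\<dots> = exp (s z) * (s_lo s j z * L z + s_0 s z * L_1 L j z) + 2 * E_0 L b j z"
    using z W B by (simp add: dy_add dy_diff dy_mult dy_exp differentiable_s_0 dy_s_0 smooth_U E_0_eq L_1_def
        algebra_simps)
  also have "dy j (\<lambda>w. \<Sum>r\<in>UNIV. L_1 L' r w * spray_diff r w) z
      = exp (s z) * (\<Sum>r\<in>UNIV. L_2 L j r z * spray_diff r z)
        + 2 * (\<Sum>r\<in>UNIV. L_1 L' r z * (nonlin_conn L' r j z - nonlin_conn L r j z))"
    using z L1 L_2_change[OF z, of _ j] L_2_sym[OF z, of j]
    by (simp add: dy_sum dy_mult differentiable_spray_diff dy_spray_diff sum.distrib L_2_def[symmetric]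
        sum_subtractf sum_distrib_left algebra_simps)
  finally show ?thesis
    by (simp add: G_1_def D_00_eq[OF z] algebra_simps)
qed

text \<open>For each fixed \<open>j\<close> the difference solves the same linear system with data
  \<open>G_2\<close> and \<open>G_1\<close>; the general solution formula is then
  \<open>D_0\<close>.\<close>

lemma nonlin_conn_change:
  assumes z: "z \<in> U"
  shows "nonlin_conn L' i j z = nonlin_conn L i j z + D_0 L L' s b i j z"
  using linear_system_solution[OF z, of "\<lambda>r. nonlin_conn L' r j z - nonlin_conn L r j z",
      OF L_2_nonlin_conn[OF z] L_1_nonlin_conn[OF z], of i]
  by (simp add: D_0_def G_up_def G_beta_def)

end

section \<open>From coordinate expressions to the manifold\<close>

theorem proposition4p3:
  fixes A :: "('m::{t2_space,second_countable_topology}, 'n::finite) chart set"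
    and c :: "('m, 'n) chart"
    and L Lbar \<beta> :: "'m tangent \<Rightarrow> real"
    and \<sigma> :: "'m \<Rightarrow> real"
    and x y :: "real ^ 'n"
    and r j :: 'n
  assumes "smooth_atlas A"
    and "finsler_metric A L"
    and "smooth_fun A \<sigma>"
    and "one_form A \<beta>"
    and "beta_conformal_change A \<sigma> \<beta> L Lbar"
    and "finsler_metric A Lbar"
    and "c \<in> A" and "x \<in> chart_image c" and "y \<noteq> 0"
  shows "spray (loc A c Lbar) r (x, y) =
           spray (loc A c L) r (x, y)
           + D_00 (loc A c L) (loc A c Lbar) (loc_fun c \<sigma>) (loc_form A c \<beta>) r (x, y)
       \<and> nonlin_conn (loc A c Lbar) r j (x, y) =
           nonlin_conn (loc A c L) r j (x, y)
           + D_0 (loc A c L) (loc A c Lbar) (loc_fun c \<sigma>) (loc_form A c \<beta>) r j (x, y)"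
proof -
  have X: "open (chart_image c)"
    using assms(1,7) by (auto simp: smooth_atlas_def)
  have chart: "finsler_chart (chart_image c) (loc A c M)" if "finsler_metric A M" for M
  proof
    note M = that[unfolded finsler_metric_def, rule_format, OF \<open>c \<in> A\<close>]
    show "open (chart_image c)" by (rule X)
    show "smooth_on (chart_image c \<times> - {0}) (loc A c M)" using M by simp
    show "loc A c M z > 0" if "z \<in> chart_image c \<times> - {0}" for z
      using M that by auto
    show "loc A c M (x, t *\<^sub>R y) = t * loc A c M (x, y)" if "x \<in> chart_image c" "t > 0" for x y t
      using M that by simp
    show "(\<Sum>i\<in>UNIV. \<Sum>j\<in>UNIV. g_lo (loc A c M) i j z * v $ i * v $ j) > 0"
      if "z \<in> chart_image c \<times> - {0}" "v \<noteq> 0" for z v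
      using M that by auto
  qed
  \<comment> \<open>The components of \<beta> are its values on the coordinate vectors
    \<open>axis i 1\<close>, read as functions of \<open>x\<close>.\<close>
  interpret beta_conformal_chart "chart_image c" "loc A c L" "loc A c Lbar" "\<sigma> \<circ> param c"
    "\<lambda>i x. \<beta> (tvec A c (x, axis i 1))"
  proof (intro beta_conformal_chart.intro chart assms beta_conformal_chart_axioms.intro)
    show "smooth_on (chart_image c) (\<sigma> \<circ> param c)"
      using assms(3,7) by (simp add: smooth_fun_def)
    show "smooth_on (chart_image c) (\<lambda>x. \<beta> (tvec A c (x, axis i 1)))" for i
      using assms(4,7) by (simp add: one_form_def)
    fix z assume z: "z \<in> chart_image c \<times> - {0 :: real ^ 'n}"
    \<comment> \<open>The change is postulated on tangent vectors only, so membership in the bundle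
      has to be shown before it can be used in coordinates.\<close>
    then have "tvec A c z \<in> tangent_bundle A"
      using assms(7) by (cases z) (force simp only: tangent_bundle_def mem_Times_iff fst_conv)
    then have "Lbar (tvec A c z) = exp (\<sigma> (fst (tvec A c z))) * L (tvec A c z) + \<beta> (tvec A c z)"
      using assms(5) by (simp add: beta_conformal_change_def)
    moreover have "\<beta> (tvec A c z) = (\<Sum>i\<in>UNIV. \<beta> (tvec A c (fst z, axis i 1)) * snd z $ i)"
      using assms(4,7) z by (cases z) (auto simp: one_form_def)
    ultimately show "loc A c Lbar z = exp ((\<sigma> \<circ> param c) (fst z)) * loc A c L z
        + (\<Sum>i\<in>UNIV. \<beta> (tvec A c (fst z, axis i 1)) * snd z $ i)"
      by (simp add: loc_def tvec_def)
  qed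
  have "(x, y) \<in> U" using assms(8,9) by (simp add: U_def)
  moreover have "loc_fun c \<sigma> = s" "loc_form A c \<beta> = b"
    by (simp_all add: fun_eq_iff loc_fun_def loc_form_def)
  ultimately show ?thesis
    using D_00_eq[of "(x, y)" r] nonlin_conn_change[of "(x, y)" r j] by (simp add: spray_diff_def)
qed

end
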